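(* Let $z\in\mathcal P_E$. If $z$ satisfies the strong hyperbolicity hypothesis, then for every $k$ the distribution $\nu_k^z$ on $\mathbb R$, defined by $$\int_{\mathbb R} f(\lambda)\,d\nu_k^z(\lambda)=\sum_{n\in\mathbb Z}\hat f(nT_z)\,\mathcal G_n(z)\,e^{-ink\theta_z^h},\qquad f\in\mathcal S(\mathbb R),$$ is an absolutely continuous measure.
   Context: Setting. $(M,\omega,J)$ is a compact Kähler manifold of complex dimension $m$; $(L,h)\to M$ is a Hermitian holomorphic line bundle with curvature form $\omega$, i.e. $\omega=i\partial\bar\partial\varphi$ with $\varphi=-\log\|e_L\|_h^2$ for a local nonvanishing holomorphic section $e_L$. $H\in C^\infty(M,\mathbb R)$ and $E\in\mathbb R$; $\xi_H$ is defined by $dH=\iota_{\xi_H}\omega$; $g^t$ is the flow of $\xi_H$. Circle bundle and holonomy. $X\subset L^*$ is the unit circle bundle, $\pi:X\to M$, with circle action $r_\theta$ and contact form $\alpha_X=d\theta-\frac12 d^c\varphi$ in the local trivialization $(z,\theta)\mapsto e^{i\theta}e_L^*(z)/\|e_L^*(z)\|$, where $d^c=i(\partial-\bar\partial)$. $\xi_H^h$ is the horizontal lift of $\xi_H$ ($\pi_*\xi_H^h=\xi_H$, $\alpha_X(\xi_H^h)=0$) and $g_h^t$ its flow on $X$. Periodic points. $\mathcal P_E=\{z\in H^{-1}(E):\exists T>0,\ g^Tz=z\}$; for $z\in\mathcal P_E$, $T_z$ denotes the minimal period $T>0$ of $z$, and $e^{in\theta_z^h}$ is the unique element of $S^1$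 with $g_h^{nT_z}x=r_{n\theta_z^h}x$ for $\pi(x)=z$. The numbers $\mathcal G_n(z)$. Choose complex linear coordinates $w=(w_1,\dots,w_m)$ on $(T_zM,J_z)$ with $\omega_z=i\sum_j dw_j\wedge d\bar w_j$. Write $\xi_H(z)=\sum_j\left(a_j\partial_{w_j}+\bar a_j\partial_{\bar w_j}\right)$ and, for $n\in\mathbb Z$, $Dg^{nT_z}_z w=P_nw+Q_n\bar w$ with complex $m\times m$ matrices $P_n,Q_n$ (so $P_n$ is the holomorphic block of $Dg_z^{nT_z}$). Put $$\mathcal G_n(z)=(\det P_n)^{-1/2}\,(\bar a\cdot P_n^{-1}a)^{-1/2},\qquad \bar a\cdot v=\sum_j\bar a_jv_j .$$ The second root is the one with positive real part; the sign of $(\det P_n)^{-1/2}$ is the one determined by the lift of $Dg_z^{nT_z}$ to the double cover (metaplectic group). Strong hyperbolicity. $z\in\mathcal P_E$ satisfies the strong hyperbolicity hypothesis if, with $T=T_z$, the matrix of $Dg_z^{T}:T_zM\to T_zM$ in a symplectic basis of $T_zM$ in which $J_z$ and $\omega_z$ take their standard forms is a symmetric positive definite symplectic matrix, and its eigenspace $V(1)$ for the eigenvalue $1$ is a 2-dimensional symplectic subspace. Fourier convention: $\hat f(t)=\frac1{2\pi}\int_{\mathbb R}f(x)e^{-itx}\,dx$.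
   Formalization: The complex dimension m of M is assumed to be at least 2: for m = 1 strong hyperbolicity forces Dg^T = id, so |G_n(z)| is constant and ν_k^z is never absolutely continuous (e.g. a Dirac comb at the equator of CP^1 with the height function). *)

theory Defs
  imports "HOL-Analysis.Analysis"
begin

section \<open>Smooth and holomorphic functions on open sets\<close>

text \<open>The set argument is always open in the uses below.\<close>

primrec Ck_on :: "nat \<Rightarrow> 'a::real_normed_vector set \<Rightarrow> ('a \<Rightarrow> 'b::real_normed_vector) \<Rightarrow> bool" where
  "Ck_on 0 S f \<longleftrightarrow> continuous_on S f"
| "Ck_on (Suc n) S f \<longleftrightarrow>
     (\<forall>x\<in>S. f differentiable (at x)) \<and> (\<forall>v. Ck_on n S (\<lambda>x. frechet_derivative f (at x) v))"

definition smooth_on :: "'a::real_normed_vector set \<Rightarrow> ('a \<Rightarrow> 'b::real_normed_vector) \<Rightarrow> bool" where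
  "smooth_on S f \<longleftrightarrow> (\<forall>n. Ck_on n S f)"

definition cholo_on :: "(complex^'m) set \<Rightarrow> (complex^'m \<Rightarrow> complex) \<Rightarrow> bool" where
  "cholo_on S f \<longleftrightarrow>
     (\<forall>x\<in>S. \<exists>D. (f has_derivative D) (at x) \<and> (\<forall>v. D (\<i> *s v) = \<i> * D v))"

text \<open>The Wirtinger derivatives \<open>\<partial>f/\<partial>z\<^sub>j\<close> and \<open>\<partial>f/\<partial>\<bar>z\<^sub>j\<close>.\<close>

definition wd :: "'m \<Rightarrow> (complex^'m \<Rightarrow> complex) \<Rightarrow> complex^'m \<Rightarrow> complex" where
  "wd j f x = (frechet_derivative f (at x) (axis j 1)
                 - \<i> * frechet_derivative f (at x) (axis j \<i>)) / 2"

definition wdbar :: "'m \<Rightarrow> (complex^'m \<Rightarrow> complex) \<Rightarrow> complex^'m \<Rightarrow> complex" where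
  "wdbar j f x = (frechet_derivative f (at x) (axis j 1)
                 + \<i> * frechet_derivative f (at x) (axis j \<i>)) / 2"

section \<open>Complex manifolds\<close>

type_synonym ('a, 'm) chart = "'a set \<times> ('a \<Rightarrow> complex^'m)"

definition chart_inv :: "('a, 'm) chart \<Rightarrow> complex^'m \<Rightarrow> 'a" where
  "chart_inv c = inv_into (fst c) (snd c)"

definition complex_atlas :: "('a::topological_space, 'm::finite) chart set \<Rightarrow> bool" where
  "complex_atlas A \<longleftrightarrow>
     (\<forall>c\<in>A. open (fst c) \<and> open (snd c ` fst c) \<and>
        homeomorphism (fst c) (snd c ` fst c) (snd c) (chart_inv c)) \<and>
     (\<Union>c\<in>A. fst c) = UNIV \<and>
     (\<forall>c\<in>A. \<forall>d\<in>A. \<forall>j. cholo_on (snd c ` (fst c \<inter> fst d)) (\<lambda>u. snd d (chart_inv c u) $ j))"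

definition holo_fun :: "('a, 'm::finite) chart set \<Rightarrow> 'a set \<Rightarrow> ('a \<Rightarrow> complex) \<Rightarrow> bool" where
  "holo_fun A U f \<longleftrightarrow> (\<forall>c\<in>A. cholo_on (snd c ` (U \<inter> fst c)) (f \<circ> chart_inv c))"

definition smooth_fun :: "('a, 'm::finite) chart set \<Rightarrow> 'a set \<Rightarrow> ('a \<Rightarrow> real) \<Rightarrow> bool" where
  "smooth_fun A U f \<longleftrightarrow> (\<forall>c\<in>A. smooth_on (snd c ` (U \<inter> fst c)) (f \<circ> chart_inv c))"

text \<open>
  A chart \<open>c\<close> around \<open>x\<close> identifies the real tangent space \<open>T\<^sub>xM\<close> with \<open>complex^'m\<close>
  (the vector \<open>v\<close> stands for \<open>\<Sum>\<^sub>j v\<^sub>j \<partial>\<^sub>j + \<bar>v\<^sub>j \<partial>\<bar>\<^sub>j\<close>); \<open>J\<close> becomes multiplication by \<open>\<i>\<close>.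
  Tensor fields are given by their components in all charts of the atlas.
\<close>

definition tangent_map ::
  "('a, 'm::finite) chart \<Rightarrow> ('a, 'm) chart \<Rightarrow> ('a \<Rightarrow> 'a) \<Rightarrow> 'a \<Rightarrow> complex^'m \<Rightarrow> complex^'m" where
  "tangent_map c d f x = frechet_derivative (\<lambda>u. snd d (f (chart_inv c u))) (at (snd c x))"

type_synonym ('a, 'm) two_form =
  "('a, 'm) chart \<Rightarrow> 'a \<Rightarrow> complex^'m \<Rightarrow> complex^'m \<Rightarrow> real"

type_synonym ('a, 'm) vfield = "('a, 'm) chart \<Rightarrow> 'a \<Rightarrow> complex^'m"

definition kahler_form :: "('a, 'm::finite) chart set \<Rightarrow> ('a, 'm) two_form \<Rightarrow> bool" where
  "kahler_form A \<omega> \<longleftrightarrow>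
     \<comment> \<open>a smooth real 2-form\<close>
     (\<forall>c\<in>A. \<forall>x\<in>fst c. bilinear (\<omega> c x) \<and> (\<forall>u. \<omega> c x u u = 0)) \<and>
     (\<forall>c\<in>A. \<forall>d\<in>A. \<forall>x\<in>fst c \<inter> fst d. \<forall>u v.
        \<omega> c x u v = \<omega> d x (tangent_map c d id x u) (tangent_map c d id x v)) \<and>
     (\<forall>c\<in>A. \<forall>u v. smooth_on (snd c ` fst c) (\<lambda>q. \<omega> c (chart_inv c q) u v)) \<and>
     \<comment> \<open>\<open>J\<close>-invariant and positive\<close>
     (\<forall>c\<in>A. \<forall>x\<in>fst c. \<forall>u v. \<omega> c x (\<i> *s u) (\<i> *s v) = \<omega> c x u v) \<and>
     (\<forall>c\<in>A. \<forall>x\<in>fst c. \<forall>u. u \<noteq> 0 \<longrightarrow> \<omega> c x u (\<i> *s u) > 0) \<and>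
     \<comment> \<open>closed\<close>
     (\<forall>c\<in>A. \<forall>q\<in>snd c ` fst c. \<forall>u v w.
        frechet_derivative (\<lambda>q. \<omega> c (chart_inv c q) v w) (at q) u
        - frechet_derivative (\<lambda>q. \<omega> c (chart_inv c q) u w) (at q) v
        + frechet_derivative (\<lambda>q. \<omega> c (chart_inv c q) u v) (at q) w = 0)"

definition compact_kahler_manifold ::
  "('a::{t2_space, second_countable_topology}, 'm::finite) chart set \<Rightarrow> ('a, 'm) two_form \<Rightarrow> bool" where
  "compact_kahler_manifold A \<omega> \<longleftrightarrow>
     compact (UNIV :: 'a set) \<and> complex_atlas A \<and> kahler_form A \<omega>"

section \<open>Hermitian holomorphic line bundles and the circle bundle\<close>

text \<open>
  A line bundle is a projection \<open>p : L \<rightarrow> M\<close> with a set \<open>\<Theta>\<close> of local trivializations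
  \<open>v \<mapsto> (p v, \<tau> v)\<close> whose transition functions are holomorphic and nonvanishing.  The
  topology of \<open>L\<close> and the linear structure of its fibres are those transported by \<open>\<Theta>\<close>.
  The metric is given by its norm function \<open>N\<close> on \<open>L\<close>.
\<close>

type_synonym ('a, 'l) triv = "'a set \<times> ('l \<Rightarrow> complex)"

definition holomorphic_line_bundle ::
  "('a::topological_space, 'm::finite) chart set \<Rightarrow> ('l \<Rightarrow> 'a) \<Rightarrow> ('a, 'l) triv set \<Rightarrow> bool" where
  "holomorphic_line_bundle A p \<Theta> \<longleftrightarrow>
     (\<forall>(U, \<tau>)\<in>\<Theta>. open U \<and> bij_betw (\<lambda>v. (p v, \<tau> v)) (p -` U) (U \<times> UNIV)) \<and>
     (\<Union>(U, \<tau>)\<in>\<Theta>. U) = UNIV \<and>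
     (\<forall>(U, \<tau>)\<in>\<Theta>. \<forall>(V, \<sigma>)\<in>\<Theta>. \<exists>\<gamma>. holo_fun A (U \<inter> V) \<gamma> \<and> (\<forall>x\<in>U \<inter> V. \<gamma> x \<noteq> 0) \<and>
        (\<forall>v. p v \<in> U \<inter> V \<longrightarrow> \<sigma> v = \<gamma> (p v) * \<tau> v))"

definition hermitian_metric ::
  "('a, 'm::finite) chart set \<Rightarrow> ('l \<Rightarrow> 'a) \<Rightarrow> ('a, 'l) triv set \<Rightarrow> ('l \<Rightarrow> real) \<Rightarrow> bool" where
  "hermitian_metric A p \<Theta> N \<longleftrightarrow>
     (\<forall>(U, \<tau>)\<in>\<Theta>. \<exists>\<rho>. smooth_fun A U \<rho> \<and> (\<forall>x\<in>U. \<rho> x > 0) \<and>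
        (\<forall>v. p v \<in> U \<longrightarrow> N v = \<rho> (p v) * cmod (\<tau> v)))"

text \<open>Local nonvanishing holomorphic sections.\<close>

definition local_frame ::
  "('a::topological_space, 'm::finite) chart set \<Rightarrow> ('l \<Rightarrow> 'a) \<Rightarrow> ('a, 'l) triv set
     \<Rightarrow> 'a set \<Rightarrow> ('a \<Rightarrow> 'l) \<Rightarrow> bool" where
  "local_frame A p \<Theta> U e \<longleftrightarrow> open U \<and> (\<forall>x\<in>U. p (e x) = x) \<and>
     (\<forall>(V, \<tau>)\<in>\<Theta>. holo_fun A (U \<inter> V) (\<lambda>x. \<tau> (e x)) \<and> (\<forall>x\<in>U \<inter> V. \<tau> (e x) \<noteq> 0))"

text \<open>\<open>\<phi> = - log \<parallel>e\<parallel>\<^sup>2\<close> in the coordinates of \<open>c\<close>, as a complex-valued function.\<close>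

definition potential ::
  "('l \<Rightarrow> real) \<Rightarrow> ('a \<Rightarrow> 'l) \<Rightarrow> ('a, 'm) chart \<Rightarrow> complex^'m \<Rightarrow> complex" where
  "potential N e c q = complex_of_real (- ln ((N (e (chart_inv c q)))\<^sup>2))"

text \<open>\<open>\<omega> = i \<partial>\<partial>\<bar>\<phi> = i \<Sum>\<^sub>j\<^sub>k (\<partial>\<^sub>j \<partial>\<bar>\<^sub>k \<phi>) dz\<^sub>j \<and> d\<bar>z\<^sub>k\<close>, with
  \<open>(\<alpha> \<and> \<beta>)(u,v) = \<alpha> u \<beta> v - \<alpha> v \<beta> u\<close>.\<close>

definition curvature_is ::
  "('a::topological_space, 'm::finite) chart set \<Rightarrow> ('l \<Rightarrow> 'a) \<Rightarrow> ('a, 'l) triv set \<Rightarrow> ('l \<Rightarrow> real)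
     \<Rightarrow> ('a, 'm) two_form \<Rightarrow> bool" where
  "curvature_is A p \<Theta> N \<omega> \<longleftrightarrow>
     (\<forall>U e. local_frame A p \<Theta> U e \<longrightarrow> (\<forall>c\<in>A. \<forall>x\<in>U \<inter> fst c. \<forall>u v.
        complex_of_real (\<omega> c x u v) =
          \<i> * (\<Sum>j\<in>UNIV. \<Sum>k\<in>UNIV. wd j (wdbar k (potential N e c)) (snd c x) *
                 (u $ j * cnj (v $ k) - v $ j * cnj (u $ k)))))"

text \<open>
  The unit circle bundle \<open>X \<subseteq> L\<^sup>*\<close>.  An element of \<open>L\<^sup>*\<close> over \<open>x\<close> is a pair \<open>(x, l)\<close>
  where \<open>l\<close> is linear on the fibre over \<open>x\<close> (that is, a multiple of \<open>\<tau>\<close> there) and zero elsewhere.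
\<close>

definition circle_bundle ::
  "('l \<Rightarrow> 'a) \<Rightarrow> ('a, 'l) triv set \<Rightarrow> ('l \<Rightarrow> real) \<Rightarrow> ('a \<times> ('l \<Rightarrow> complex)) set" where
  "circle_bundle p \<Theta> N =
     {(x, l). (\<forall>(U, \<tau>)\<in>\<Theta>. x \<in> U \<longrightarrow> (\<exists>\<kappa>. \<forall>v. p v = x \<longrightarrow> l v = \<kappa> * \<tau> v)) \<and>
              (\<forall>v. p v \<noteq> x \<longrightarrow> l v = 0) \<and> (\<forall>v. p v = x \<longrightarrow> cmod (l v) = N v)}"

definition rotate_by :: "real \<Rightarrow> 'a \<times> ('l \<Rightarrow> complex) \<Rightarrow> 'a \<times> ('l \<Rightarrow> complex)" where
  "rotate_by \<theta> y = (fst y, \<lambda>v. cis \<theta> * snd y v)"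

text \<open>
  \<open>y = e\<^sup>i\<^sup>\<theta> e\<^sup>* / \<parallel>e\<^sup>*\<parallel>\<close>, where \<open>e\<^sup>*\<close> is the dual frame; since \<open>\<parallel>e\<^sup>*\<parallel> = 1 / \<parallel>e\<parallel>\<close>,
  evaluation on \<open>e\<close> gives \<open>e\<^sup>i\<^sup>\<theta> \<parallel>e\<parallel>\<close>.
\<close>

definition has_angle ::
  "('l \<Rightarrow> real) \<Rightarrow> ('a \<Rightarrow> 'l) \<Rightarrow> 'a \<times> ('l \<Rightarrow> complex) \<Rightarrow> real \<Rightarrow> bool" where
  "has_angle N e y \<theta> \<longleftrightarrow> snd y (e (fst y)) = cis \<theta> * complex_of_real (N (e (fst y)))"

text \<open>\<open>d\<^sup>c f = i (\<partial>f - \<partial>\<bar>f)\<close>, which is real for real \<open>f\<close>.\<close>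

definition dc_form :: "(complex^'m::finite \<Rightarrow> complex) \<Rightarrow> complex^'m \<Rightarrow> complex^'m \<Rightarrow> real" where
  "dc_form f q v =
     Re (\<i> * ((\<Sum>j\<in>UNIV. wd j f q * v $ j) - (\<Sum>j\<in>UNIV. wdbar j f q * cnj (v $ j))))"

text \<open>
  The contact form \<open>\<alpha>\<^sub>X = d\<theta> - \<onehalf> d\<^sup>c\<phi>\<close> at a point of \<open>X\<close> over \<open>x\<close>, on the tangent vector with
  components \<open>(v, s)\<close> in the coordinates \<open>(z, \<theta>)\<close> given by \<open>c\<close> and \<open>e\<close>.  It does not
  depend on \<open>\<theta>\<close>, and hence neither does a horizontal lift.
\<close>

definition contact_form ::
  "('l \<Rightarrow> real) \<Rightarrow> ('a, 'm::finite) chart \<Rightarrow> ('a \<Rightarrow> 'l) \<Rightarrow> 'a \<Rightarrow> (complex^'m) \<times> real \<Rightarrow> real" where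
  "contact_form N c e x = (\<lambda>(v, s). s - dc_form (potential N e c) (snd c x) v / 2)"

definition horizontal_lift ::
  "('a::topological_space, 'm::finite) chart set \<Rightarrow> ('l \<Rightarrow> 'a) \<Rightarrow> ('a, 'l) triv set \<Rightarrow> ('l \<Rightarrow> real)
     \<Rightarrow> ('a, 'm) vfield \<Rightarrow> (('a, 'm) chart \<Rightarrow> ('a \<Rightarrow> 'l) \<Rightarrow> 'a \<Rightarrow> (complex^'m) \<times> real) \<Rightarrow> bool" where
  "horizontal_lift A p \<Theta> N \<xi> \<xi>h \<longleftrightarrow>
     (\<forall>U e. local_frame A p \<Theta> U e \<longrightarrow> (\<forall>c\<in>A. \<forall>x\<in>U \<inter> fst c.
        fst (\<xi>h c e x) = \<xi> c x \<and> contact_form N c e x (\<xi>h c e x) = 0))"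

section \<open>Hamiltonian flow, horizontal flow, periodic points\<close>

definition hamiltonian_field ::
  "('a, 'm::finite) chart set \<Rightarrow> ('a, 'm) two_form \<Rightarrow> ('a \<Rightarrow> real) \<Rightarrow> ('a, 'm) vfield \<Rightarrow> bool" where
  "hamiltonian_field A \<omega> H \<xi> \<longleftrightarrow>
     (\<forall>c\<in>A. \<forall>x\<in>fst c. \<forall>v.
        frechet_derivative (H \<circ> chart_inv c) (at (snd c x)) v = \<omega> c x (\<xi> c x) v)"

text \<open>The (complete) flow: a smooth action of the additive group of reals with generator \<open>\<xi>\<close>.\<close>

definition flow_of ::
  "('a::topological_space, 'm::finite) chart set \<Rightarrow> ('a, 'm) vfield \<Rightarrow> (real \<Rightarrow> 'a \<Rightarrow> 'a) \<Rightarrow> bool" where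
  "flow_of A \<xi> g \<longleftrightarrow>
     (\<forall>x. g 0 x = x) \<and> (\<forall>s t x. g (s + t) x = g s (g t x)) \<and>
     continuous_on UNIV (\<lambda>(t, x). g t x) \<and>
     (\<forall>c\<in>A. \<forall>d\<in>A. smooth_on {(t, q). q \<in> snd c ` fst c \<and> g t (chart_inv c q) \<in> fst d}
                     (\<lambda>(t, q). snd d (g t (chart_inv c q)))) \<and>
     (\<forall>c\<in>A. \<forall>t x. g t x \<in> fst c \<longrightarrow>
        ((\<lambda>s. snd c (g s x)) has_vector_derivative \<xi> c (g t x)) (at t))"

text \<open>Likewise on \<open>X\<close>; the angle is a multivalued coordinate, so near each time one
  uses some local determination \<open>\<theta>\<close> of it along the orbit.\<close>

definition circle_flow_of ::
  "('a::topological_space, 'm::finite) chart set \<Rightarrow> ('l \<Rightarrow> 'a) \<Rightarrow> ('a, 'l) triv set \<Rightarrow> ('l \<Rightarrow> real)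
     \<Rightarrow> (('a, 'm) chart \<Rightarrow> ('a \<Rightarrow> 'l) \<Rightarrow> 'a \<Rightarrow> (complex^'m) \<times> real)
     \<Rightarrow> (real \<Rightarrow> 'a \<times> ('l \<Rightarrow> complex) \<Rightarrow> 'a \<times> ('l \<Rightarrow> complex)) \<Rightarrow> bool" where
  "circle_flow_of A p \<Theta> N \<xi>h gh \<longleftrightarrow>
     (\<forall>y\<in>circle_bundle p \<Theta> N.
        gh 0 y = y \<and> (\<forall>t. gh t y \<in> circle_bundle p \<Theta> N) \<and>
        (\<forall>s t. gh (s + t) y = gh s (gh t y)) \<and>
        (\<forall>t. \<forall>c\<in>A. \<forall>U e. local_frame A p \<Theta> U e \<longrightarrow> fst (gh t y) \<in> U \<inter> fst c \<longrightarrow>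
           (\<exists>\<theta>. (\<forall>\<^sub>F s in nhds t. fst (gh s y) \<in> U \<inter> fst c \<and> has_angle N e (gh s y) (\<theta> s)) \<and>
                ((\<lambda>s. (snd c (fst (gh s y)), \<theta> s))
                   has_vector_derivative \<xi>h c e (fst (gh t y))) (at t))))"

definition periodic_points :: "(real \<Rightarrow> 'a \<Rightarrow> 'a) \<Rightarrow> ('a \<Rightarrow> real) \<Rightarrow> real \<Rightarrow> 'a set" where
  "periodic_points g H E = {z. H z = E \<and> (\<exists>T>0. g T z = z)}"

text \<open>A stationary point has no minimal period.\<close>

definition minimal_period :: "(real \<Rightarrow> 'a \<Rightarrow> 'a) \<Rightarrow> 'a \<Rightarrow> real \<Rightarrow> bool" where
  "minimal_period g z T \<longleftrightarrow> T > 0 \<and> g T z = z \<and> (\<forall>S. 0 < S \<and> S < T \<longrightarrow> g S z \<noteq> z)"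

text \<open>\<open>\<theta>\<close> represents \<open>\<theta>\<^sub>z\<^sup>h\<close>, which is determined modulo \<open>2\<pi>\<close>.\<close>

definition holonomy_angle ::
  "('a \<times> ('l \<Rightarrow> complex)) set \<Rightarrow> (real \<Rightarrow> 'a \<times> ('l \<Rightarrow> complex) \<Rightarrow> 'a \<times> ('l \<Rightarrow> complex))
     \<Rightarrow> 'a \<Rightarrow> real \<Rightarrow> real \<Rightarrow> bool" where
  "holonomy_angle X gh z T \<theta> \<longleftrightarrow>
     (\<forall>n::int. \<forall>y\<in>X. fst y = z \<longrightarrow> gh (of_int n * T) y = rotate_by (of_int n * \<theta>) y)"

section \<open>The linear symplectic group and the metaplectic group\<close>

type_synonym 'm cmat = "complex^'m^'m"

definition cnj_vec :: "complex^'m \<Rightarrow> complex^'m" where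
  "cnj_vec v = (\<chi> j. cnj (v $ j))"

definition cnj_mat :: "'m::finite cmat \<Rightarrow> 'm cmat" where
  "cnj_mat P = (\<chi> i j. cnj (P $ i $ j))"

text \<open>\<open>i \<Sum>\<^sub>j dw\<^sub>j \<and> d\<bar>w\<^sub>j\<close>\<close>

definition std_form :: "complex^'m::finite \<Rightarrow> complex^'m \<Rightarrow> complex" where
  "std_form u v = \<i> * (\<Sum>j\<in>UNIV. u $ j * cnj (v $ j) - v $ j * cnj (u $ j))"

text \<open>
  Complex linear coordinates \<open>w\<close> on \<open>T\<^sub>zM\<close>, i.e. on \<open>complex^'m\<close> via a chart, in which
  the symplectic form \<open>W\<close> is standard.
\<close>

definition standard_coords ::
  "(complex^'m::finite \<Rightarrow> complex^'m \<Rightarrow> real) \<Rightarrow> (complex^'m \<Rightarrow> complex^'m) \<Rightarrow> bool" where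
  "standard_coords W w \<longleftrightarrow>
     (\<forall>u v. w (u + v) = w u + w v) \<and> (\<forall>a u. w (a *s u) = a *s w u) \<and> bij w \<and>
     (\<forall>u v. complex_of_real (W u v) = std_form (w u) (w v))"

text \<open>
  The metaplectic group, as the connected double cover of the group of symplectic maps
  \<open>w \<mapsto> P w + Q \<bar>w\<close>: its elements are the triples \<open>(P, Q, s)\<close> with \<open>s\<close> one of the two
  values of \<open>(det P)\<^bsup>-1/2\<^esup>\<close>.
\<close>

definition metaplectic :: "('m::finite cmat \<times> 'm cmat \<times> complex) set" where
  "metaplectic = {(P, Q, s).
     (\<forall>u v. std_form (P *v u + Q *v cnj_vec u) (P *v v + Q *v cnj_vec v) = std_form u v) \<and>
     s\<^sup>2 * det P = 1}"

text \<open>The value at \<open>1\<close> of the continuous branch of \<open>f\<^bsup>-1/2\<^esup>\<close> on \<open>[0,1]\<close> that starts at \<open>1\<close>.\<close>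

definition inv_sqrt_branch :: "(real \<Rightarrow> complex) \<Rightarrow> complex" where
  "inv_sqrt_branch f = (THE l. \<exists>r. continuous_on {0..1} r \<and> r 0 = 1 \<and>
     (\<forall>\<tau>\<in>{0..1}. (r \<tau>)\<^sup>2 * f \<tau> = 1) \<and> l = r 1)"

text \<open>
  The holomorphic block of the composite is
  \<open>P\<^sub>1 P\<^sub>2 + Q\<^sub>1 \<bar>Q\<^sub>2 = P\<^sub>1 (1 + P\<^sub>1\<^bsup>-1\<^esup> Q\<^sub>1 \<bar>Q\<^sub>2 P\<^sub>2\<^bsup>-1\<^esup>) P\<^sub>2\<close>.  Since \<open>P\<^sub>1\<^bsup>-1\<^esup> Q\<^sub>1\<close> and \<open>\<bar>Q\<^sub>2 P\<^sub>2\<^bsup>-1\<^esup>\<close> are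
  strict contractions, \<open>det (1 + \<tau> P\<^sub>1\<^bsup>-1\<^esup> Q\<^sub>1 \<bar>Q\<^sub>2 P\<^sub>2\<^bsup>-1\<^esup>)\<close> does not vanish for \<open>0 \<le> \<tau> \<le> 1\<close>, and
  continuity forces this choice of the sign.
\<close>

fun mp_mult ::
  "'m::finite cmat \<times> 'm cmat \<times> complex \<Rightarrow> 'm cmat \<times> 'm cmat \<times> complex
     \<Rightarrow> 'm cmat \<times> 'm cmat \<times> complex" where
  "mp_mult (P1, Q1, s1) (P2, Q2, s2) =
     (P1 ** P2 + Q1 ** cnj_mat Q2, P1 ** Q2 + Q1 ** cnj_mat P2,
      s1 * s2 * inv_sqrt_branch (\<lambda>\<tau>.
        det (mat 1 + \<tau> *\<^sub>R (matrix_inv P1 ** Q1 ** cnj_mat Q2 ** matrix_inv P2))))"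

text \<open>
  \<open>s\<close> is the third component of a lift of the homomorphism \<open>n \<mapsto> (P\<^sub>n, Q\<^sub>n)\<close> from the
  integers to the metaplectic group.  For the linearized flow at a periodic point these are
  the values at the multiples of the period of the path in the metaplectic group that starts at
  the identity and covers the linearized flow, read in a periodic unitary frame along the orbit;
  the two homotopy classes mod 2 of such frames give the two lifts.
\<close>

definition metaplectic_lift ::
  "(int \<Rightarrow> 'm::finite cmat) \<Rightarrow> (int \<Rightarrow> 'm cmat) \<Rightarrow> (int \<Rightarrow> complex) \<Rightarrow> bool" where
  "metaplectic_lift P Q s \<longleftrightarrow>
     (\<forall>n. (P n, Q n, s n) \<in> metaplectic) \<and>
     (\<forall>n k. (P (n + k), Q (n + k), s (n + k)) = mp_mult (P n, Q n, s n) (P k, Q k, s k))"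

text \<open>\<open>(det P)\<^bsup>-1/2\<^esup> (\<bar>a \<cdot> P\<^bsup>-1\<^esup> a)\<^bsup>-1/2\<^esup>\<close>, with \<open>s\<close> the chosen value of \<open>(det P)\<^bsup>-1/2\<^esup>\<close>.\<close>

definition G_number :: "'m::finite cmat \<Rightarrow> complex \<Rightarrow> complex^'m \<Rightarrow> complex" where
  "G_number P s a =
     s * inverse (csqrt (\<Sum>j\<in>UNIV. cnj (a $ j) * (matrix_inv P *v a) $ j))"

section \<open>Strong hyperbolicity\<close>

text \<open>The symplectic basis \<open>e\<^sub>j = b (Inl j)\<close>, \<open>f\<^sub>j = b (Inr j)\<close>, with \<open>J e\<^sub>j = f\<^sub>j\<close>.\<close>

definition symplectic_basis ::
  "(complex^'m::finite \<Rightarrow> complex^'m \<Rightarrow> real) \<Rightarrow> ('m + 'm \<Rightarrow> complex^'m) \<Rightarrow> bool" where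
  "symplectic_basis W b \<longleftrightarrow>
     inj b \<and> independent (range b) \<and> span (range b) = UNIV \<and>
     (\<forall>j k. W (b (Inl j)) (b (Inl k)) = 0 \<and> W (b (Inr j)) (b (Inr k)) = 0 \<and>
            W (b (Inl j)) (b (Inr k)) = (if j = k then 1 else 0)) \<and>
     (\<forall>j. b (Inr j) = \<i> *s b (Inl j))"

definition std_symplectic :: "real^('m::finite + 'm)^('m + 'm)" where
  "std_symplectic = (\<chi> p q. case (p, q) of
     (Inl j, Inr k) \<Rightarrow> if j = k then 1 else 0
   | (Inr j, Inl k) \<Rightarrow> if j = k then - 1 else 0
   | _ \<Rightarrow> 0)"

text \<open>
  \<open>S\<close> is the matrix of \<open>D\<close> in the basis \<open>b\<close>.  In complex dimension one the condition on the
  eigenspace for the eigenvalue \<open>1\<close> just says \<open>S = 1\<close>, so that there is no hyperbolic direction.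
\<close>

definition strongly_hyperbolic ::
  "(complex^'m::finite \<Rightarrow> complex^'m \<Rightarrow> real) \<Rightarrow> (complex^'m \<Rightarrow> complex^'m) \<Rightarrow> bool" where
  "strongly_hyperbolic W D \<longleftrightarrow>
     (\<exists>b (S :: real^('m + 'm)^('m + 'm)).
        symplectic_basis W b \<and> (\<forall>q. D (b q) = (\<Sum>p\<in>UNIV. S $ p $ q *\<^sub>R b p)) \<and>
        transpose S = S \<and> (\<forall>x. x \<noteq> 0 \<longrightarrow> x \<bullet> (S *v x) > 0) \<and>
        transpose S ** std_symplectic ** S = std_symplectic \<and>
        dim {x. S *v x = x} = 2 \<and>
        (\<forall>x. S *v x = x \<longrightarrow> (\<forall>y. S *v y = y \<longrightarrow> x \<bullet> (std_symplectic *v y) = 0) \<longrightarrow> x = 0))"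

section \<open>Distributions on the line\<close>

definition vderiv :: "(real \<Rightarrow> complex) \<Rightarrow> real \<Rightarrow> complex" where
  "vderiv f x = vector_derivative f (at x)"

definition schwartz :: "(real \<Rightarrow> complex) \<Rightarrow> bool" where
  "schwartz f \<longleftrightarrow>
     (\<forall>n x. (vderiv ^^ n) f differentiable (at x)) \<and>
     (\<forall>k n. bounded (range (\<lambda>x. x ^ k *\<^sub>R (vderiv ^^ n) f x)))"

definition fourier :: "(real \<Rightarrow> complex) \<Rightarrow> real \<Rightarrow> complex" where
  "fourier f t = 1 / (2 * pi) * (LINT x|lborel. f x * exp (- \<i> * t * x))"

text \<open>
  The functional on Schwartz functions is integration against an absolutely continuous
  complex Radon measure \<open>\<nu>\<close>, written in its polar decomposition \<open>\<nu> = h \<bar>\<nu>\<bar>\<close>,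
  \<open>\<bar>h\<bar> = 1\<close>; absolute continuity of \<open>\<nu>\<close> means that of its total variation \<open>\<mu> = \<bar>\<nu>\<bar>\<close>.
\<close>

definition abs_continuous_complex_measure :: "((real \<Rightarrow> complex) \<Rightarrow> complex) \<Rightarrow> bool" where
  "abs_continuous_complex_measure \<Lambda> \<longleftrightarrow>
     (\<exists>(\<mu> :: real measure) (h :: real \<Rightarrow> complex).
        sets \<mu> = sets borel \<and> (\<forall>K. compact K \<longrightarrow> emeasure \<mu> K < \<infinity>) \<and>
        h \<in> borel_measurable borel \<and> (\<forall>x. cmod (h x) = 1) \<and>
        absolutely_continuous lborel \<mu> \<and>
        (\<forall>f. schwartz f \<longrightarrow> integrable \<mu> f \<and> \<Lambda> f = (LINT x|\<mu>. f x * h x)))"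

definition nu_term ::
  "real \<Rightarrow> (int \<Rightarrow> complex) \<Rightarrow> real \<Rightarrow> nat \<Rightarrow> (real \<Rightarrow> complex) \<Rightarrow> int \<Rightarrow> complex" where
  "nu_term T G \<theta> k f n =
     fourier f (of_int n * T) * G n * exp (- \<i> * of_int n * of_nat k * of_real \<theta>)"

definition nu_distribution ::
  "real \<Rightarrow> (int \<Rightarrow> complex) \<Rightarrow> real \<Rightarrow> nat \<Rightarrow> (real \<Rightarrow> complex) \<Rightarrow> complex" where
  "nu_distribution T G \<theta> k f = (\<Sum>\<^sub>\<infinity>n. nu_term T G \<theta> k f n)"

end

theory Submission
  imports Defs "HOL-Probability.Sinc_Integral"
begin

text \<open>
  Let \<open>D\<close> be the linearized first return map and \<open>P\<^sub>n\<close> the holomorphic block of \<open>D\<^sup>n\<close>.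
  In unitary coordinates \<open>D\<close> is self-adjoint, positive and symplectic, so
  \<open>J\<^sup>-\<^sup>1 D J = D\<^sup>-\<^sup>1\<close> and \<open>P\<^sub>n = (D\<^sup>n + D\<^sup>-\<^sup>n) / 2\<close>.  The flow preserves its generator \<open>a\<close>,
  hence \<open>P\<^sub>n a = a\<close> and \<open>\<G>\<^sub>n\<close> is \<open>(det P\<^sub>n)\<^bsup>-1/2\<^esup>\<close> times a constant.  As \<open>V(1)\<close> is not
  everything, \<open>D\<close> has an eigenvalue \<open>d > 1\<close>; then \<open>P\<^sub>n\<close> stretches an eigenvector by
  \<open>cosh (n log d)\<close> and contracts nothing, so \<open>\<bar>det P\<^sub>n\<bar>\<close> grows exponentially.  Thus
  \<open>\<G>\<^sub>n\<close> is absolutely summable, whatever the signs of the roots, and \<open>\<nu>\<^sub>k\<close> has the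
  bounded continuous density \<open>(1/2\<pi>) \<Sum>\<^sub>n \<G>\<^sub>n e\<^bsup>-ink\<theta>\<^esup> e\<^bsup>-inTx\<^esup>\<close>.
\<close>

section \<open>Self-adjoint symplectic maps\<close>

definition real_map :: "'m::finite cmat \<Rightarrow> 'm cmat \<Rightarrow> complex^'m \<Rightarrow> complex^'m" where
  "real_map P Q u = P *v u + Q *v cnj_vec u"

lemma linear_real_map: "linear (real_map P Q)"
  by (rule linearI)
    (simp_all add: real_map_def cnj_vec_def matrix_vector_mult_def vec_eq_iff sum.distrib
      algebra_simps scaleR_sum_right)

text \<open>The pair on the right is formed by the first two components of \<open>mp_mult\<close>,
  so products in the metaplectic group become compositions.\<close>

lemma real_map_compose:
  "real_map P1 Q1 (real_map P2 Q2 u)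
     = real_map (P1 ** P2 + Q1 ** cnj_mat Q2) (P1 ** Q2 + Q1 ** cnj_mat P2) u"
proof -
  have "cnj_vec (P2 *v u + Q2 *v cnj_vec u) = cnj_mat P2 *v cnj_vec u + cnj_mat Q2 *v u"
    by (simp add: cnj_vec_def cnj_mat_def matrix_vector_mult_def vec_eq_iff)
  then show ?thesis
    by (simp add: real_map_def matrix_vector_right_distrib matrix_vector_mult_add_rdistrib
        matrix_vector_mul_assoc)
qed

lemma imult_imult [simp]: "\<i> *s (\<i> *s u) = - u" for u :: "complex^'m"
  by (simp add: vec_eq_iff flip: mult.assoc)

lemma imult_diff [simp]: "\<i> *s (u - v) = \<i> *s u - \<i> *s v" for u :: "complex^'m"
  by (simp add: vec_eq_iff algebra_simps)

lemma imult_eq_0_iff [simp]: "\<i> *s u = 0 \<longleftrightarrow> u = 0" for u :: "complex^'m"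
  by (simp add: vec_eq_iff)

lemma inner_imult_imult [simp]: "(\<i> *s u) \<bullet> (\<i> *s v) = u \<bullet> v" for u :: "complex^'m::finite"
  by (simp add: inner_vec_def inner_complex_def add.commute)

lemma inner_imult_left: "(\<i> *s u) \<bullet> v = - (u \<bullet> (\<i> *s v))" for u :: "complex^'m::finite"
  using inner_imult_imult[of u "\<i> *s v"] by simp

text \<open>Conjugation by \<i> fixes the complex-linear part and negates the conjugate-linear one,
  so averaging isolates \<open>P\<close>.\<close>

lemma holomorphic_part:
  "2 *\<^sub>R (P *v u) = real_map P Q u - \<i> *s real_map P Q (\<i> *s u)"
proof -
  have "cnj_vec (\<i> *s u) = - (\<i> *s cnj_vec u)"
    by (simp add: cnj_vec_def vec_eq_iff)
  moreover have "P *v (\<i> *s u) = \<i> *s (P *v u)" "Q *v (- (\<i> *s cnj_vec u)) = - (\<i> *s (Q *v cnj_vec u))"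
    by (simp_all add: matrix_vector_mult_def vec_eq_iff sum_distrib_left sum_negf algebra_simps)
  moreover have "\<i> *s (x + y) = \<i> *s x + \<i> *s y" for x y :: "complex^'a"
    by (simp add: vec_eq_iff algebra_simps)
  ultimately show ?thesis
    by (simp add: real_map_def scaleR_2)
qed

text \<open>The bracket in \<open>std_form\<close> is a number minus its conjugate, so the form is
  real: it is twice the inner product twisted by \<i>.\<close>

lemma std_form_inner: "std_form u v = complex_of_real (2 * ((\<i> *s u) \<bullet> v))"
proof -
  have "Re (std_form u v) = 2 * ((\<i> *s u) \<bullet> v)" "Im (std_form u v) = 0"
    by (simp_all add: std_form_def inner_vec_def inner_complex_def sum.distrib
        sum_subtractf sum_negf sum_distrib_left algebra_simps)
  then show ?thesis
    by (simp add: complex_eq_iff)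
qed

definition symplectic_map :: "(complex^'m \<Rightarrow> complex^'m::finite) \<Rightarrow> bool" where
  "symplectic_map D \<longleftrightarrow> linear D \<and> (\<forall>u v. (\<i> *s D u) \<bullet> D v = (\<i> *s u) \<bullet> v)"

definition self_adjoint :: "('a::real_inner \<Rightarrow> 'a) \<Rightarrow> bool" where
  "self_adjoint D \<longleftrightarrow> (\<forall>u v. D u \<bullet> v = u \<bullet> D v)"

lemma symplectic_map_real_map:
  assumes "(P, Q, s) \<in> metaplectic"
  shows "symplectic_map (real_map P Q)"
proof -
  have "std_form (real_map P Q u) (real_map P Q v) = std_form u v" for u v
    using assms by (simp add: metaplectic_def real_map_def)
  then have "(\<i> *s real_map P Q u) \<bullet> real_map P Q v = (\<i> *s u) \<bullet> v" for u v
    unfolding std_form_inner of_real_eq_iff by simp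
  then show ?thesis
    by (simp add: symplectic_map_def linear_real_map)
qed

text \<open>If \<open>D x = 0\<close> for \<open>x = u - v\<close>, the form pairs
  \<open>D x\<close> and \<open>D (\<i> *s x)\<close> to zero; by invariance that pairing is the
  squared norm of \<open>x\<close>.\<close>

lemma symplectic_map_inj:
  assumes "symplectic_map D" "D u = D v"
  shows "u = v"
proof -
  have "D (u - v) = 0"
    using assms by (simp add: symplectic_map_def linear_diff)
  then have "(\<i> *s D (u - v)) \<bullet> D (\<i> *s (u - v)) = 0"
    by simp
  then have "(\<i> *s (u - v)) \<bullet> (\<i> *s (u - v)) = 0"
    using assms(1) unfolding symplectic_map_def by metis
  then show ?thesis
    by (simp only: inner_eq_zero_iff imult_eq_0_iff right_minus_eq)
qed

text \<open>\<open>J\<^sup>-\<^sup>1 D J\<close>; for \<open>D\<close> symplectic and self-adjoint this is \<open>D\<^sup>-\<^sup>1\<close>.\<close>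

definition conj_i :: "(complex^'m \<Rightarrow> complex^'m) \<Rightarrow> complex^'m \<Rightarrow> complex^'m" where
  "conj_i D u = - (\<i> *s D (\<i> *s u))"

text \<open>Self-adjointness turns \<open>D (conj_i D u) \<bullet> v\<close> into minus the
  symplectic pairing of \<open>D (\<i> *s u)\<close> and \<open>D v\<close>, where invariance
  removes \<open>D\<close>. Injectivity makes the right inverse two-sided.\<close>

lemma symplectic_conj_i:
  assumes D: "symplectic_map D" and sa: "self_adjoint D"
  shows "D (conj_i D u) = u" and "conj_i D (D u) = u"
proof -
  have 1: "D (conj_i D u) = u" for u
  proof -
    have "D (conj_i D u) \<bullet> v = u \<bullet> v" for v
    proof -
      have "D (conj_i D u) \<bullet> v = conj_i D u \<bullet> D v"
        using sa by (simp add: self_adjoint_def)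
      also have "\<dots> = - ((\<i> *s D (\<i> *s u)) \<bullet> D v)"
        by (simp add: conj_i_def)
      also have "\<dots> = u \<bullet> v"
        using D by (simp add: symplectic_map_def)
      finally show ?thesis .
    qed
    then have "\<forall>v. D (conj_i D u) \<bullet> v = u \<bullet> v" ..
    then show ?thesis
      by (simp only: vector_eq_rdot)
  qed
  show "D (conj_i D u) = u"
    by (rule 1)
  show "conj_i D (D u) = u"
    by (rule symplectic_map_inj[OF D]) (rule 1)
qed

lemma holomorphic_part_conj_i:
  "2 *\<^sub>R (P *v u) = real_map P Q u + conj_i (real_map P Q) u"
  by (simp add: holomorphic_part[of P u Q] conj_i_def)

text \<open>For self-adjoint \<open>D\<close>, \<open>2 P = D + D\<^sup>-\<^sup>1\<close> and \<open>\<langle>D u, D\<^sup>-\<^sup>1 u\<rangle> = \<parallel>u\<parallel>\<^sup>2\<close>.\<close>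

lemma norm_holomorphic_part_ge:
  assumes D: "symplectic_map (real_map P Q)" and sa: "self_adjoint (real_map P Q)"
  shows "norm u \<le> norm (P *v u)"
proof -
  let ?D = "real_map P Q" let ?K = "conj_i ?D"
  have DK: "?D u \<bullet> ?K u = u \<bullet> u"
    using sa symplectic_conj_i(1)[OF D sa] by (simp add: self_adjoint_def)
  have "0 \<le> (?D u - ?K u) \<bullet> (?D u - ?K u)"
    by simp
  then have "4 * (u \<bullet> u) \<le> (?D u + ?K u) \<bullet> (?D u + ?K u)"
    using DK by (simp add: inner_add inner_diff inner_commute)
  also have "\<dots> = 4 * ((P *v u) \<bullet> (P *v u))"
    by (simp flip: holomorphic_part_conj_i)
  finally show ?thesis
    by (simp add: norm_le)
qed

text \<open>On \<open>v\<close> the inverse of the map, given by \<open>conj_i\<close>, has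
  eigenvalue \<open>inverse d\<close>, and \<open>P\<close> is the mean of the map and its
  inverse.\<close>

lemma symplectic_eigenvector:
  assumes D: "symplectic_map (real_map P Q)" and sa: "self_adjoint (real_map P Q)"
    and ev: "real_map P Q v = d *\<^sub>R v" and d: "d \<noteq> 0"
  shows "P *v v = ((d + inverse d) / 2) *\<^sub>R v"
proof -
  let ?K = "conj_i (real_map P Q)"
  have lin: "?K (r *\<^sub>R x) = r *\<^sub>R ?K x" for r x
  proof -
    have "\<i> *s (r *\<^sub>R y) = r *\<^sub>R (\<i> *s y)" for y :: "complex^'a"
      by (simp add: vec_eq_iff)
    then show ?thesis
      by (simp add: conj_i_def linear_cmul[OF linear_real_map])
  qed
  have "v = d *\<^sub>R ?K v"
    using symplectic_conj_i(2)[OF D sa, of v] by (simp add: ev lin)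
  then have "?K v = inverse d *\<^sub>R v"
    using d by (metis divideR_right)
  then have "2 *\<^sub>R (P *v v) = (d + inverse d) *\<^sub>R v"
    by (simp add: holomorphic_part_conj_i[of P v Q] ev scaleR_add_left)
  then have "(1 / 2) *\<^sub>R (2 *\<^sub>R (P *v v)) = (1 / 2) *\<^sub>R ((d + inverse d) *\<^sub>R v)"
    by (rule arg_cong)
  then show ?thesis
    by simp
qed

section \<open>Largest eigenvalue of a self-adjoint symplectic map\<close>

text \<open>A maximizer of the Rayleigh quotient on the compact unit sphere is an eigenvector for
  the largest eigenvalue.\<close>

lemma self_adjoint_max_eigenvalue:
  fixes f :: "'a::euclidean_space \<Rightarrow> 'a"
  assumes lin: "linear f" and sa: "self_adjoint f"
  obtains v d where "v \<noteq> 0" "f v = d *\<^sub>R v" "\<And>x. x \<bullet> f x \<le> d * (x \<bullet> x)"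
proof -
  have cf: "continuous_on A f" for A
    by (simp add: lin linear_continuous_on linear_linear)
  have "\<exists>v\<in>sphere 0 1. \<forall>x\<in>sphere 0 1. x \<bullet> f x \<le> v \<bullet> f v"
    by (rule continuous_attains_sup) (auto intro!: continuous_intros cf)
  then obtain v where v: "norm v = 1" and max: "\<And>x. norm x = 1 \<Longrightarrow> x \<bullet> f x \<le> v \<bullet> f v"
    by auto
  define d where "d = v \<bullet> f v"
  have le: "x \<bullet> f x \<le> d * (x \<bullet> x)" for x
  proof (cases "x = 0")
    case False
    have "(inverse (norm x) *\<^sub>R x) \<bullet> f (inverse (norm x) *\<^sub>R x) \<le> d"
      using max[of "inverse (norm x) *\<^sub>R x"] False by (simp add: d_def)
    then have "inverse (norm x) * inverse (norm x) * (x \<bullet> f x) \<le> d"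
      by (simp add: linear_cmul[OF lin] mult.assoc)
    then show ?thesis
      using False by (simp add: field_simps dot_square_norm power2_eq_square)
  qed (simp add: linear_0[OF lin])
  \<comment> \<open>\<open>B\<close> is positive semidefinite and its quadratic form vanishes at
    \<open>v\<close>. Perturbing \<open>v\<close> in the direction \<open>B v\<close> shows that
    this forces \<open>B v = 0\<close>.\<close>
  define B where "B x = d *\<^sub>R x - f x" for x
  have B_nonneg: "0 \<le> B x \<bullet> x" for x
    using le[of x] by (simp add: B_def inner_diff inner_commute)
  have Bv: "B v \<bullet> v = 0"
    using v by (simp add: B_def inner_diff inner_commute d_def dot_square_norm)
  have "B v = 0"
  proof (rule ccontr)
    assume nz: "B v \<noteq> 0"
    define y where "y = B v"
    have quad: "0 \<le> 2 * t * (y \<bullet> y) + t\<^sup>2 * (B y \<bullet> y)" for t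
    proof -
      have "B (v + t *\<^sub>R y) = y + t *\<^sub>R B y"
        by (simp add: B_def y_def linear_add[OF lin] linear_cmul[OF lin] linear_diff[OF lin] algebra_simps)
      moreover have "B y \<bullet> v = y \<bullet> y"
        using sa by (simp add: B_def y_def self_adjoint_def inner_diff inner_commute linear_diff[OF lin] linear_cmul[OF lin] algebra_simps)
      ultimately show ?thesis
        using B_nonneg[of "v + t *\<^sub>R y"] Bv
        by (simp add: inner_add algebra_simps power2_eq_square flip: y_def)
    qed
    define c where "c = B y \<bullet> y"
    have c: "c \<ge> 0" unfolding c_def by (rule B_nonneg)
    have y: "y \<bullet> y > 0" using nz by (simp add: y_def)
    have "0 \<le> 2 * (- ((y \<bullet> y) / (c + 1))) * (y \<bullet> y) + (- ((y \<bullet> y) / (c + 1)))\<^sup>2 * c"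
      unfolding c_def by (rule quad)
    also have "\<dots> = - ((y \<bullet> y)\<^sup>2 * (c + 2) / (c + 1)\<^sup>2)"
      using c by (simp add: divide_simps) (simp add: algebra_simps power2_eq_square power3_eq_cube)
    also have "\<dots> < 0"
      using c y by simp
    finally show False
      by simp
  qed
  then have "f v = d *\<^sub>R v"
    by (simp add: B_def)
  moreover have "v \<noteq> 0"
    using v by auto
  ultimately show ?thesis
    using that le by blast
qed

text \<open>If the largest eigenvalue were at most 1, both \<open>D\<close> and its inverse, a
  conjugate of \<open>D\<close> by \<i>, would be bounded by the identity, which leaves only
  \<open>D = id\<close>.\<close>

lemma symplectic_eigenvalue_gt_1:
  assumes D: "symplectic_map D" and sa: "self_adjoint D"
    and pos: "\<And>x. x \<noteq> 0 \<Longrightarrow> 0 < x \<bullet> D x" and nid: "D \<noteq> id"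
  obtains v d where "v \<noteq> 0" "D v = d *\<^sub>R v" "1 < d"
proof -
  have lin: "linear D"
    using D by (simp add: symplectic_map_def)
  obtain v d where v: "v \<noteq> 0" "D v = d *\<^sub>R v" and max: "\<And>x. x \<bullet> D x \<le> d * (x \<bullet> x)"
    using self_adjoint_max_eigenvalue[OF lin sa] by blast
  have "1 < d"
  proof (rule ccontr)
    assume "\<not> 1 < d"
    then have le: "x \<bullet> D x \<le> x \<bullet> x" for x
      using max[of x] mult_right_mono[of d 1 "x \<bullet> x"] by simp
    let ?K = "conj_i D"
    have K: "x \<bullet> ?K x = (\<i> *s x) \<bullet> D (\<i> *s x)" for x
      by (simp add: conj_i_def inner_imult_left)
    have "D x = x" for x
    proof (rule ccontr)
      assume nx: "D x \<noteq> x"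
      \<comment> \<open>The form \<open>y \<bullet> ?K y\<close> expands to that of
        \<open>D - 2 + ?K\<close> at \<open>x\<close>. It is nonpositive by the two bounds, yet
        positive for nonzero \<open>y\<close> because \<open>D\<close> is positive definite.\<close>
      define y where "y = D x - x"
      have "?K y = x - ?K x"
        using symplectic_conj_i(2)[OF D sa, of x]
        by (simp add: y_def conj_i_def linear_diff[OF lin])
      moreover have "D x \<bullet> ?K x = x \<bullet> x"
        using sa symplectic_conj_i(1)[OF D sa] by (simp add: self_adjoint_def)
      ultimately have "y \<bullet> ?K y = x \<bullet> D x - 2 * (x \<bullet> x) + x \<bullet> ?K x"
        by (simp add: y_def inner_diff inner_commute)
      also have "\<dots> \<le> 0"
        using le[of x] le[of "\<i> *s x"] by (simp add: K)
      finally have "\<not> 0 < (\<i> *s y) \<bullet> D (\<i> *s y)"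
        by (simp add: K)
      then show False
        using pos[of "\<i> *s y"] nx by (simp add: y_def)
    qed
    then show False
      using nid by auto
  qed
  with v that show ?thesis
    by blast
qed

section \<open>Lower bound for the determinant of the holomorphic block\<close>

lemma norm_det_le:
  fixes A :: "complex^'n::finite^'n"
  assumes "\<And>i j. cmod (A $ i $ j) \<le> M"
  shows "cmod (det A) \<le> fact CARD('n) * M ^ CARD('n)"
proof -
  have "cmod (of_int (sign p) * (\<Prod>i\<in>UNIV. A $ i $ p i)) \<le> M ^ CARD('n)" for p
  proof -
    have "cmod (of_int (sign p)) = 1"
      by (simp add: sign_def)
    moreover have "(\<Prod>i\<in>UNIV. cmod (A $ i $ p i)) \<le> (\<Prod>i\<in>(UNIV::'n set). M)"
      by (rule prod_mono) (simp add: assms)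
    ultimately show ?thesis
      by (simp add: norm_mult prod_norm)
  qed
  then have "cmod (det A) \<le> (\<Sum>p\<in>{p. p permutes (UNIV::'n set)}. M ^ CARD('n))"
    unfolding det_def by (intro sum_norm_le) auto
  then show ?thesis
    by (simp add: card_permutations)
qed

lemma matrix_inv_mult:
  fixes A :: "'a::field^'n::finite^'n"
  assumes "det A \<noteq> 0"
  shows "A ** matrix_inv A = mat 1" and "matrix_inv A ** A = mat 1"
proof -
  have "\<exists>B. A ** B = mat 1 \<and> B ** A = mat 1"
    using assms invertible_det_nz[of A] by (simp add: invertible_def)
  then have "A ** matrix_inv A = mat 1 \<and> matrix_inv A ** A = mat 1"
    unfolding matrix_inv_def by (rule someI_ex)
  then show "A ** matrix_inv A = mat 1" and "matrix_inv A ** A = mat 1"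
    by blast+
qed

text \<open>
  Since \<open>P\<^sup>-\<^sup>1\<close> is a contraction with \<open>P\<^sup>-\<^sup>1 v = v / c\<close>, Cramer's rule writes
  \<open>v\<^sub>k det P\<^sup>-\<^sup>1\<close> as \<open>1/c\<close> times a determinant with bounded entries.
\<close>

lemma det_holomorphic_part_bound:
  fixes P Q :: "'m::finite cmat"
  assumes D: "symplectic_map (real_map P Q)" and sa: "self_adjoint (real_map P Q)"
    and det: "det P \<noteq> 0" and ev: "P *v v = c *\<^sub>R v" and c: "c > 0" and M: "1 \<le> M" "norm v \<le> M"
  shows "c * cmod (v $ k) \<le> fact CARD('m) * M ^ CARD('m) * cmod (det P)"
proof -
  define R where "R = matrix_inv P"
  have PR: "P ** R = mat 1" and RP: "R ** P = mat 1"
    using matrix_inv_mult[OF det] by (simp_all add: R_def)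
  have R: "norm (R *v x) \<le> norm x" for x
    using norm_holomorphic_part_ge[OF D sa, of "R *v x"]
    by (simp add: matrix_vector_mul_assoc PR)
  have entry: "cmod (R $ i $ j) \<le> 1" for i j
  proof -
    have "cmod (R $ i $ j) = norm ((R *v axis j 1) $ i)"
      by (simp add: matrix_vector_mult_def axis_def if_distrib cong: if_cong)
    also have "\<dots> \<le> norm (R *v axis j 1)"
      by (rule Finite_Cartesian_Product.norm_nth_le)
    also have "\<dots> \<le> norm (axis j (1::complex) :: complex^'m)"
      by (rule R)
    also have "\<dots> = 1"
      by (simp add: norm_eq_sqrt_inner inner_axis_axis)
    finally show ?thesis .
  qed
  have Rv: "R *v (c *\<^sub>R v) = v"
    by (simp add: matrix_vector_mul_assoc RP flip: ev)
  have "cmod (v $ i) \<le> M" for i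
    using Finite_Cartesian_Product.norm_nth_le[of v i] M by linarith
  \<comment> \<open>Column \<open>k\<close> of \<open>R\<close> is replaced by
    \<open>R *v (c *\<^sub>R v)\<close>, which is \<open>v\<close>; Cramer evaluates the same
    determinant as \<open>c * v $ k * det R\<close>.\<close>
  then have "cmod (det (\<chi> i j. if j = k then (R *v (c *\<^sub>R v)) $ i else R $ i $ j))
      \<le> fact CARD('m) * M ^ CARD('m)"
    using entry M(1) by (intro norm_det_le) (auto simp: Rv intro: order_trans)
  then have "cmod ((c *\<^sub>R v) $ k * det R) \<le> fact CARD('m) * M ^ CARD('m)"
    by (simp only: cramer_lemma)
  moreover have "det R * det P = 1"
    by (metis RP det_I det_mul)
  ultimately show ?thesis
    using c det by (metis (no_types, lifting) abs_of_pos mult.assoc mult.right_neutral mult_right_mono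
        norm_ge_zero norm_mult norm_one norm_scaleR vector_scaleR_component)
qed

section \<open>Decay along a metaplectic lift\<close>

lemma metaplectic_lift_add:
  assumes "metaplectic_lift P Q s"
  shows "real_map (P (n + k)) (Q (n + k)) u = real_map (P n) (Q n) (real_map (P k) (Q k) u)"
  using assms by (simp add: metaplectic_lift_def real_map_compose)

lemma metaplectic_lift_symplectic:
  assumes "metaplectic_lift P Q s"
  shows "symplectic_map (real_map (P n) (Q n))"
  using assms symplectic_map_real_map by (auto simp: metaplectic_lift_def)

text \<open>The map at 0 is idempotent by additivity and injective, hence the identity.\<close>

lemma metaplectic_lift_0:
  assumes "metaplectic_lift P Q s"
  shows "real_map (P 0) (Q 0) u = u"
  using metaplectic_lift_add[OF assms, of 0 0 u]
    symplectic_map_inj[OF metaplectic_lift_symplectic[OF assms, of 0]] by fastforce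

lemma metaplectic_lift_minus:
  assumes "metaplectic_lift P Q s"
  shows "real_map (P n) (Q n) (real_map (P (- n)) (Q (- n)) u) = u"
  using metaplectic_lift_add[OF assms, of n "- n" u] by (simp add: metaplectic_lift_0[OF assms])

lemma metaplectic_lift_det:
  assumes "metaplectic_lift P Q s"
  shows "(s n)\<^sup>2 * det (P n) = 1" and "det (P n) \<noteq> 0"
proof -
  show "(s n)\<^sup>2 * det (P n) = 1"
    using assms by (simp add: metaplectic_lift_def metaplectic_def)
  then show "det (P n) \<noteq> 0"
    by auto
qed

lemma metaplectic_lift_self_adjoint:
  assumes lift: "metaplectic_lift P Q s" and sa: "self_adjoint (real_map (P 1) (Q 1))"
  shows "self_adjoint (real_map (P n) (Q n))"
proof -
  define D where "D n = real_map (P n) (Q n)" for n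
  have add: "D (n + k) u = D n (D k u)" for n k u
    unfolding D_def by (rule metaplectic_lift_add[OF lift])
  have nat: "D (int j) u \<bullet> v = u \<bullet> D (int j) v" for j u v
  proof (induction j arbitrary: u v)
    case 0
    show ?case by (simp add: D_def metaplectic_lift_0[OF lift])
  next
    case (Suc j)
    have "D (int (Suc j)) u \<bullet> v = D 1 (D (int j) u) \<bullet> v"
      using add[of 1 "int j" u] by simp
    also have "\<dots> = D (int j) u \<bullet> D 1 v"
      using sa by (simp add: self_adjoint_def D_def)
    also have "\<dots> = u \<bullet> D (int j) (D 1 v)"
      by (rule Suc)
    also have "D (int j) (D 1 v) = D (int (Suc j)) v"
      using add[of "int j" 1 v] by (simp add: add.commute)
    finally show ?case .
  qed
  have inv: "D m (D (- m) u) = u" for m u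
    unfolding D_def by (rule metaplectic_lift_minus[OF lift])
  \<comment> \<open>Write \<open>v\<close> as \<open>D (int j) (D (- int j) v)\<close>, move
    \<open>D (int j)\<close> across, and cancel it on \<open>u\<close>.\<close>
  have neg: "D (- int j) u \<bullet> v = u \<bullet> D (- int j) v" for j u v
    by (metis nat inv)
  have "D n u \<bullet> v = u \<bullet> D n v" for u v
    by (cases n rule: int_cases2) (simp_all add: nat neg)
  then show ?thesis
    by (simp add: self_adjoint_def D_def)
qed

text \<open>The \<open>n\<close>-th map scales \<open>v\<close> by the \<open>n\<close>-th power of
  \<open>d\<close>, and the mean with the inverse gives \<open>cosh (n * ln d)\<close>. This is even
  in \<open>n\<close>, hence the absolute value.\<close>

lemma metaplectic_lift_eigenvector:
  assumes lift: "metaplectic_lift P Q s" and sa: "self_adjoint (real_map (P 1) (Q 1))"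
    and ev: "real_map (P 1) (Q 1) v = d *\<^sub>R v" and d: "d > 0"
  shows "P n *v v = ((d ^ nat \<bar>n\<bar> + inverse (d ^ nat \<bar>n\<bar>)) / 2) *\<^sub>R v"
proof -
  define D where "D n = real_map (P n) (Q n)" for n
  have lin: "D n (r *\<^sub>R x) = r *\<^sub>R D n x" for n r x
    unfolding D_def by (rule linear_cmul[OF linear_real_map])
  have nat: "D (int j) v = (d ^ j) *\<^sub>R v" for j
  proof (induction j)
    case 0
    show ?case by (simp add: D_def metaplectic_lift_0[OF lift])
  next
    case (Suc j)
    have "D (int (Suc j)) v = D 1 (D (int j) v)"
      using metaplectic_lift_add[OF lift, of 1 "int j" v] by (simp add: D_def)
    then show ?case
      using ev by (simp add: Suc lin) (simp add: D_def mult.commute)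
  qed
  have neg: "D (- int j) v = inverse (d ^ j) *\<^sub>R v" for j
  proof -
    have "D (- int j) (D (int j) v) = v"
      using metaplectic_lift_minus[OF lift, of "- int j" v] by (simp add: D_def)
    then have "(d ^ j) *\<^sub>R D (- int j) v = v"
      by (simp add: nat lin)
    then show ?thesis
      using d by (metis divideR_right power_not_zero less_irrefl)
  qed
  have *: "P n *v v = ((r + inverse r) / 2) *\<^sub>R v" if "D n v = r *\<^sub>R v" "r \<noteq> 0" for r
    using symplectic_eigenvector[OF metaplectic_lift_symplectic[OF lift]
        metaplectic_lift_self_adjoint[OF lift sa]] that by (simp add: D_def)
  show ?thesis
  proof (cases n rule: int_cases2)
    case (nonneg j)
    then show ?thesis using *[of "d ^ j"] nat[of j] d by simp
  next
    case (nonpos j)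
    then show ?thesis using *[of "inverse (d ^ j)"] neg[of j] d by (simp add: add.commute)
  qed
qed

lemma summable_on_power_nat_abs:
  fixes r :: real
  assumes "0 \<le> r" "r < 1"
  shows "(\<lambda>n::int. r ^ nat \<bar>n\<bar>) summable_on UNIV"
proof -
  have g: "(\<lambda>n. r ^ n) summable_on (UNIV :: nat set)"
    using assms by (intro norm_summable_imp_summable_on) (simp add: norm_power summable_geometric)
  have "(\<lambda>n::int. r ^ nat \<bar>n\<bar>) summable_on range int"
    using g by (subst summable_on_reindex) (auto simp: o_def)
  moreover have "(\<lambda>n::int. r ^ nat \<bar>n\<bar>) summable_on range (\<lambda>n. - int n)"
    using g by (subst summable_on_reindex) (auto simp: o_def inj_on_def)
  ultimately have "(\<lambda>n::int. r ^ nat \<bar>n\<bar>) summable_on (range int \<union> range (\<lambda>n. - int n))"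
    by (rule summable_on_union)
  moreover have "n \<in> range int \<union> range (\<lambda>n. - int n)" for n
    by (cases n rule: int_cases2) auto
  then have "range int \<union> range (\<lambda>n. - int n) = UNIV"
    by blast
  ultimately show ?thesis
    by simp
qed

text \<open>Since \<open>(s n)\<^sup>2 * det (P n) = 1\<close>, exponential growth of the
  determinant becomes geometric decay of \<open>s n\<close> with ratio
  \<open>1 / sqrt d\<close>.\<close>

lemma metaplectic_lift_summable:
  fixes P Q :: "int \<Rightarrow> 'm::finite cmat"
  assumes lift: "metaplectic_lift P Q s" and sa: "self_adjoint (real_map (P 1) (Q 1))"
    and pos: "\<And>x. x \<noteq> 0 \<Longrightarrow> 0 < x \<bullet> real_map (P 1) (Q 1) x"
    and nid: "real_map (P 1) (Q 1) \<noteq> id"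
  shows "(\<lambda>n. cmod (s n)) summable_on UNIV"
proof -
  obtain v d where v: "v \<noteq> 0" "real_map (P 1) (Q 1) v = d *\<^sub>R v" and d: "1 < d"
    using symplectic_eigenvalue_gt_1[OF metaplectic_lift_symplectic[OF lift] sa pos nid] by blast
  obtain k where k: "v $ k \<noteq> 0"
    using v(1) by (auto simp: vec_eq_iff)
  \<comment> \<open>\<open>M\<close> bounds the entries of \<open>v\<close> and of the contraction
    in Cramer's rule. The 2 in \<open>C\<close> comes from estimating
    \<open>(e + inverse e) / 2\<close> below by \<open>e / 2\<close>.\<close>
  define M where "M = max 1 (norm v)"
  define C where "C = fact CARD('m) * M ^ CARD('m) * 2 / cmod (v $ k)"
  have bound: "cmod (s n) \<le> sqrt C * (1 / sqrt d) ^ nat \<bar>n\<bar>" for n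
  proof -
    define e where "e = d ^ nat \<bar>n\<bar>"
    have e: "e > 0"
      using d by (simp add: e_def)
    note s = metaplectic_lift_det[OF lift, of n]
    have "(e + inverse e) / 2 * cmod (v $ k) \<le> fact CARD('m) * M ^ CARD('m) * cmod (det (P n))"
      by (rule det_holomorphic_part_bound[OF metaplectic_lift_symplectic[OF lift]
            metaplectic_lift_self_adjoint[OF lift sa] s(2)])
        (use metaplectic_lift_eigenvector[OF lift sa v(2), of n] d e in
          \<open>auto simp: M_def e_def intro: add_pos_pos\<close>)
    moreover have "e / 2 * cmod (v $ k) \<le> (e + inverse e) / 2 * cmod (v $ k)"
      using e by (intro mult_right_mono) auto
    ultimately have "e \<le> C * cmod (det (P n))"
      using k by (simp add: C_def field_simps)
    moreover have "(cmod (s n))\<^sup>2 * cmod (det (P n)) = 1"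
      using s(1) by (metis norm_mult norm_one norm_power)
    ultimately have "(cmod (s n))\<^sup>2 * e \<le> C"
      using mult_left_mono[of e "C * cmod (det (P n))" "(cmod (s n))\<^sup>2"]
      by (simp add: mult.left_commute[of _ C])
    then have "(cmod (s n))\<^sup>2 \<le> C / e"
      using e by (simp add: field_simps)
    then have "cmod (s n) \<le> sqrt (C / e)"
      using real_le_rsqrt by blast
    also have "\<dots> = sqrt C * (1 / sqrt d) ^ nat \<bar>n\<bar>"
      by (simp add: e_def real_sqrt_divide real_sqrt_power power_one_over)
    finally show ?thesis .
  qed
  have "(\<lambda>n::int. sqrt C * (1 / sqrt d) ^ nat \<bar>n\<bar>) summable_on UNIV"
    using d by (intro summable_on_cmult_right summable_on_power_nat_abs) auto
  then show ?thesis
    by (rule Infinite_Sum.abs_summable_on_comparison_test') (rule bound)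
qed

text \<open>The case \<open>d = 1\<close> of the eigenvector formula. It makes the second root in
  \<open>G_number\<close> independent of \<open>n\<close>.\<close>

lemma metaplectic_lift_fixed:
  assumes lift: "metaplectic_lift P Q s" and sa: "self_adjoint (real_map (P 1) (Q 1))"
    and fixed: "real_map (P 1) (Q 1) a = a"
  shows "matrix_inv (P n) *v a = a"
proof -
  have "P n *v a = a"
    using metaplectic_lift_eigenvector[OF lift sa, of a 1 n] fixed by simp
  then show ?thesis
    by (metis matrix_inv_mult(2)[OF metaplectic_lift_det(2)[OF lift]] matrix_vector_mul_assoc matrix_vector_mul_lid)
qed

section \<open>The linearized flow\<close>

lemma standard_coords_linear:
  assumes "standard_coords W w"
  shows "linear w"
proof (rule linearI)
  fix r :: real and u
  have *: "r *\<^sub>R x = complex_of_real r *s x" for x :: "complex^'a"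
    by (simp add: vec_eq_iff) (simp add: scaleR_conv_of_real)
  show "w (r *\<^sub>R u) = r *\<^sub>R w u"
    unfolding * using assms by (simp add: standard_coords_def)
qed (use assms in \<open>simp add: standard_coords_def\<close>)

text \<open>The coordinates \<open>w\<close> carry the symplectic basis to an orthogonal basis of
  vectors of squared length \<open>1 / 2\<close>, as \<open>std_form\<close> is twice an inner
  product. So symmetry and positivity of \<open>S\<close> pass to \<open>F\<close>.\<close>

lemma strongly_hyperbolic_standard_coords:
  fixes W :: "complex^'m::finite \<Rightarrow> complex^'m \<Rightarrow> real"
  assumes coords: "standard_coords W w" and hyp: "strongly_hyperbolic W D"
    and F: "\<And>u. w (D u) = F (w u)" "linear F" and card: "CARD('m) \<ge> 2"
  shows "self_adjoint F" and "\<And>x. x \<noteq> 0 \<Longrightarrow> 0 < x \<bullet> F x" and "F \<noteq> id"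
proof -
  from hyp obtain b and S :: "real^('m + 'm)^('m + 'm)" where
    b: "symplectic_basis W b" and D: "\<And>q. D (b q) = (\<Sum>p\<in>UNIV. S $ p $ q *\<^sub>R b p)"
    and sym: "transpose S = S" and pos: "\<And>x. x \<noteq> 0 \<Longrightarrow> x \<bullet> (S *v x) > 0"
    and dim: "dim {x. S *v x = x} = 2"
    unfolding strongly_hyperbolic_def by blast
  have w: "linear w" by (rule standard_coords_linear[OF coords])
  have W: "W u v = 2 * ((\<i> *s w u) \<bullet> w v)" for u v
    using coords unfolding standard_coords_def std_form_inner of_real_eq_iff by simp
  define e where "e q = w (b q)" for q
  have e_Inr: "e (Inr j) = \<i> *s e (Inl j)" for j
    using b coords by (simp add: e_def symplectic_basis_def standard_coords_def)
  have e_Inl: "(\<i> *s e (Inl j)) \<bullet> e (Inl k) = 0" "2 * (e (Inl j) \<bullet> e (Inl k)) = (if j = k then 1 else 0)"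
    for j k
  proof -
    have "W (b (Inl j)) (b (Inl k)) = 0" "W (b (Inl j)) (b (Inr k)) = (if j = k then 1 else 0)"
      using b[unfolded symplectic_basis_def] by (blast, metis)
    then show "(\<i> *s e (Inl j)) \<bullet> e (Inl k) = 0" "2 * (e (Inl j) \<bullet> e (Inl k)) = (if j = k then 1 else 0)"
      unfolding W e_def[symmetric] e_Inr by simp_all
  qed
  have orth: "e p \<bullet> e q = (if p = q then 1 / 2 else 0)" for p q
  proof -
    have "e (Inl j) \<bullet> e (Inl k) = (if j = k then 1 / 2 else 0)" for j k
      using e_Inl(2)[of j k] by (simp split: if_splits)
    then show ?thesis
      using e_Inl(1) by (cases p; cases q) (auto simp: e_Inr inner_commute)
  qed
  \<comment> \<open>Up to the factor \<open>1 / sqrt 2\<close>, \<open>\<phi>\<close> is an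
    isometry; it intertwines \<open>S\<close> with \<open>F\<close>.\<close>
  define \<phi> where "\<phi> x = (\<Sum>q\<in>UNIV. x $ q *\<^sub>R e q)" for x :: "real^('m + 'm)"
  have lin: "linear \<phi>"
    by (rule linearI) (simp_all add: \<phi>_def scaleR_add_left sum.distrib scaleR_sum_right)
  have inner: "\<phi> x \<bullet> \<phi> y = (x \<bullet> y) / 2" for x y
  proof -
    have "\<phi> x \<bullet> \<phi> y = (\<Sum>q\<in>UNIV. y $ q * x $ q / 2)"
      by (simp add: \<phi>_def inner_sum_left inner_sum_right orth if_distrib cong: if_cong)
    then show ?thesis
      by (simp add: inner_vec_def sum_divide_distrib mult.commute)
  qed
  have Fe: "F (e q) = (\<Sum>p\<in>UNIV. S $ p $ q *\<^sub>R e p)" for q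
    by (simp add: e_def linear_sum[OF w] linear_cmul[OF w] D flip: F(1))
  have F\<phi>: "F (\<phi> x) = \<phi> (S *v x)" for x
  proof -
    have "F (\<phi> x) = (\<Sum>q\<in>UNIV. \<Sum>p\<in>UNIV. (S $ p $ q * x $ q) *\<^sub>R e p)"
      by (simp add: \<phi>_def linear_sum[OF F(2)] linear_cmul[OF F(2)] Fe scaleR_sum_right mult.commute)
    also have "\<dots> = (\<Sum>p\<in>UNIV. \<Sum>q\<in>UNIV. (S $ p $ q * x $ q) *\<^sub>R e p)"
      by (rule sum.swap)
    also have "\<dots> = \<phi> (S *v x)"
      by (simp add: \<phi>_def matrix_vector_mult_def scaleR_sum_left)
    finally show ?thesis .
  qed
  have "range \<phi> = UNIV"
  proof -
    have "e q = \<phi> (axis q 1)" for q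
      by (simp add: \<phi>_def axis_def if_distrib[of "\<lambda>r. r *\<^sub>R _"] cong: if_cong)
    then have "range e \<subseteq> range \<phi>"
      by auto
    then have "span (range e) \<subseteq> range \<phi>"
      by (intro span_minimal linear_subspace_image[OF lin] subspace_UNIV)
    moreover have "span (range e) = w ` span (range b)"
      using linear_span_image[OF w, of "range b"] by (simp add: e_def image_image)
    moreover have "span (range b) = UNIV" "range w = UNIV"
      using b coords by (auto simp: symplectic_basis_def standard_coords_def bij_def)
    ultimately show ?thesis
      by auto
  qed
  then have surj: "\<exists>x. u = \<phi> x" for u
    by (metis surjD)
  have "(S *v x) \<bullet> y = x \<bullet> (S *v y)" for x y
    by (metis dot_lmul_matrix sym transpose_matrix_vector)
  then show "self_adjoint F"
    unfolding self_adjoint_def by (metis surj F\<phi> inner)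
  show "0 < u \<bullet> F u" if "u \<noteq> 0" for u
  proof -
    obtain x where x: "u = \<phi> x"
      using surj by blast
    then have "x \<noteq> 0"
      using that linear_0[OF lin] by auto
    then show ?thesis
      using pos by (simp add: x F\<phi> inner)
  qed
  show "F \<noteq> id"
  proof
    assume "F = id"
    then have "\<phi> (S *v x - x) = 0" for x
      using F\<phi>[of x] by (simp add: linear_diff[OF lin])
    then have "S *v x = x" for x
      using inner[of "S *v x - x" "S *v x - x"] by simp
    \<comment> \<open>The eigenspace for 1 would be the whole space, whose dimension
      \<open>2 * CARD('m)\<close> is at least 4.\<close>
    then have "dim (UNIV :: (real^('m + 'm)) set) = 2"
      using dim by simp
    then show False
      using card by simp
  qed
qed

text \<open>Differentiate \<open>g T (g s z) = g s z\<close> at \<open>s = 0\<close>, where the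
  orbit has velocity \<open>\<xi> c z\<close>.\<close>

lemma flow_fixes_generator:
  fixes A :: "('a::topological_space, 'm::finite) chart set"
  assumes A: "complex_atlas A" and flow: "flow_of A \<xi> g" and c: "c \<in> A" "z \<in> fst c" and T: "g T z = z"
  shows "tangent_map c c (g T) z (\<xi> c z) = \<xi> c z"
proof -
  have inv: "chart_inv c (snd c x) = x" if "x \<in> fst c" for x
    using A c(1) that by (auto simp: complex_atlas_def homeomorphism_def)
  have op: "open (fst c)"
    using A c(1) by (auto simp: complex_atlas_def)
  have g0: "g 0 z = z"
    and group: "g (r + t) x = g r (g t x)"
    and cont: "continuous_on UNIV (\<lambda>(t, x). g t x)"
    and deriv: "g t x \<in> fst c \<Longrightarrow>
      ((\<lambda>s. snd c (g s x)) has_vector_derivative \<xi> c (g t x)) (at t)" for r t x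
    using flow c(1) unfolding flow_of_def by blast+
  define F where "F = (\<lambda>(t, q). snd c (g t (chart_inv c q)))"
  define R where "R = {(t, q). q \<in> snd c ` fst c \<and> g t (chart_inv c q) \<in> fst c}"
  have "smooth_on R F"
    using flow c(1) unfolding flow_of_def F_def R_def by blast
  then have "Ck_on (Suc 0) R F"
    unfolding smooth_on_def by blast
  then have "\<forall>x\<in>R. F differentiable (at x)"
    unfolding Ck_on.simps by (rule conjunct1)
  moreover have "(T, snd c z) \<in> R"
    using c(2) T by (simp add: inv R_def)
  ultimately have "F differentiable (at (T, snd c z))"
    by (rule bspec)
  moreover have "((\<lambda>u. (T, u)) has_derivative (\<lambda>u. (0, u))) (at (snd c z))"
    by (auto intro!: derivative_eq_intros)
  ultimately have "(\<lambda>u. F (T, u)) differentiable (at (snd c z))"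
    using differentiable_chain_at[of "\<lambda>u. (T, u)" "snd c z" F]
    by (auto simp: o_def differentiable_def)
  then have der: "((\<lambda>u. snd c (g T (chart_inv c u))) has_derivative tangent_map c c (g T) z) (at (snd c z))"
    unfolding tangent_map_def F_def by (simp add: frechet_derivative_works)
  have \<xi>: "((\<lambda>s. snd c (g s z)) has_vector_derivative \<xi> c z) (at 0)"
    using deriv[of 0 z] c(2) by (simp add: g0)
  have "((\<lambda>s. snd c (g T (chart_inv c (snd c (g s z)))))
      has_vector_derivative tangent_map c c (g T) z (\<xi> c z)) (at 0)"
  proof -
    have "((\<lambda>u. snd c (g T (chart_inv c u))) has_derivative tangent_map c c (g T) z)
        (at (snd c (g 0 z)) within range (\<lambda>s. snd c (g s z)))"
      unfolding g0 by (rule has_derivative_at_withinI[OF der])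
    from vector_derivative_diff_chain_within[OF \<xi> this] show ?thesis
      unfolding o_def .
  qed
  \<comment> \<open>By continuity the orbit stays in the chart domain for times near 0, so the
    identity holds in coordinates on a neighbourhood of 0.\<close>
  moreover have "continuous_on UNIV (\<lambda>s. (\<lambda>(t, x). g t x) (s, z))"
    by (rule continuous_on_compose2[OF cont]) (auto intro!: continuous_intros)
  then have "open ((\<lambda>s. g s z) -` fst c)"
    using op by (simp add: continuous_on_open_vimage)
  moreover have "0 \<in> (\<lambda>s. g s z) -` fst c"
    using c(2) g0 by simp
  moreover have "snd c (g T (chart_inv c (snd c (g s z)))) = snd c (g s z)"
    if "s \<in> (\<lambda>s. g s z) -` fst c" for s
  proof -
    have "g T (g s z) = g s (g T z)"
      using group[of T s z] group[of s T z] by (simp add: add.commute)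
    then show ?thesis
      using that T by (simp add: inv)
  qed
  ultimately have "((\<lambda>s. snd c (g s z)) has_vector_derivative tangent_map c c (g T) z (\<xi> c z)) (at 0)"
    by (rule has_vector_derivative_transform_within_open)
  then show ?thesis
    using \<xi> by (rule vector_derivative_unique_at)
qed

section \<open>Absolutely convergent Fourier series\<close>

lemma integrable_inverse_1_plus_sq: "integrable lborel (\<lambda>x::real. inverse (1 + x\<^sup>2))"
  using integrable_inverse_1_plus_square by (simp add: set_integrable_def)

lemma schwartz_continuous:
  assumes "schwartz f"
  shows "continuous_on UNIV f"
proof -
  have "f differentiable (at x)" for x
    using assms funpow_0[of vderiv f] unfolding schwartz_def by metis
  then show ?thesis
    by (simp add: continuous_on_eq_continuous_at differentiable_imp_continuous_within)
qed

text \<open>The Schwartz bounds for the powers 0 and 2 add up to domination by a multiple of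
  \<open>inverse (1 + x\<^sup>2)\<close>.\<close>

lemma schwartz_integrable:
  assumes "schwartz f"
  shows "integrable lborel f"
proof -
  have "bounded (range (\<lambda>x. x ^ k *\<^sub>R (vderiv ^^ 0) f x))" for k
    using assms unfolding schwartz_def by blast
  then have "\<exists>B. \<forall>x. cmod (x ^ k *\<^sub>R f x) \<le> B" for k
    by (simp add: bounded_iff)
  then obtain B where B: "cmod (x ^ k *\<^sub>R f x) \<le> B k" for k x
    by metis
  have "cmod (f x) \<le> (B 0 + B 2) * inverse (1 + x\<^sup>2)" for x
  proof -
    have "(1 + x\<^sup>2) * cmod (f x) \<le> B 0 + B 2"
      using B[of x 0] B[of x 2] by (simp add: algebra_simps)
    then show ?thesis
      by (simp add: field_simps add_pos_nonneg)
  qed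
  moreover have "integrable lborel (\<lambda>x. (B 0 + B 2) * inverse (1 + x\<^sup>2))"
    by (intro integrable_mult_right integrable_inverse_1_plus_sq)
  moreover have "f \<in> borel_measurable lborel"
    using schwartz_continuous[OF assms] by (simp add: borel_measurable_continuous_onI)
  ultimately show ?thesis
    by (intro Bochner_Integration.integrable_bound[of lborel "\<lambda>x. (B 0 + B 2) * inverse (1 + x\<^sup>2)" f])
      (auto intro!: AE_I2 intro: order_trans[OF _ abs_ge_self])
qed

lemma norm_fourier_le:
  assumes "schwartz f"
  shows "cmod (fourier f t) \<le> (LINT x|lborel. cmod (f x)) / (2 * pi)"
proof -
  have "cmod (LINT x|lborel. f x * exp (- \<i> * t * x)) \<le> (LINT x|lborel. cmod (f x * exp (- \<i> * t * x)))"
    by (rule integral_norm_bound)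
  also have "\<dots> = (LINT x|lborel. cmod (f x))"
    by (simp add: norm_mult)
  finally show ?thesis
    by (simp add: fourier_def norm_mult norm_divide divide_right_mono)
qed

lemma fourier_series_summable:
  assumes f: "schwartz f" and a: "(\<lambda>n. cmod (a n)) summable_on UNIV"
  shows "(\<lambda>n::int. fourier f (of_int n * T) * a n) summable_on UNIV"
proof (rule Infinite_Sum.abs_summable_summable, rule Infinite_Sum.abs_summable_on_comparison_test')
  show "(\<lambda>n. (LINT x|lborel. cmod (f x)) / (2 * pi) * cmod (a n)) summable_on UNIV"
    by (rule summable_on_cmult_right[OF a])
  show "cmod (fourier f (of_int n * T) * a n) \<le> (LINT x|lborel. cmod (f x)) / (2 * pi) * cmod (a n)" for n
    unfolding norm_mult by (rule mult_right_mono[OF norm_fourier_le[OF f]]) simp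
qed

text \<open>Enumerating the integers turns the unordered sum into an ordinary series, the form in
  which it is exchanged with an integral.\<close>

lemma infsum_int_decode:
  fixes F :: "int \<Rightarrow> complex"
  assumes "F summable_on UNIV"
  shows "infsum F UNIV = (\<Sum>j. F (int_decode j))"
proof -
  have bij: "bij_betw int_decode UNIV UNIV"
    by (rule bij_int_decode)
  have "(\<lambda>j. F (int_decode j)) summable_on UNIV"
    using summable_on_reindex_bij_betw[OF bij, of F] assms by simp
  then have "(\<lambda>j. F (int_decode j)) sums infsum (\<lambda>j. F (int_decode j)) UNIV"
    by (intro has_sum_imp_sums has_sum_infsum)
  then show ?thesis
    using infsum_reindex_bij_betw[OF bij, of F] by (simp add: sums_iff)
qed

text \<open>Polar decomposition: the total variation has density \<open>cmod (\<rho> x)\<close>.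
  Boundedness of \<open>\<rho>\<close> gives finite mass on compact sets and integrability of
  Schwartz functions.\<close>

lemma abs_continuous_complex_measure_density:
  fixes \<rho> :: "real \<Rightarrow> complex"
  assumes [measurable]: "\<rho> \<in> borel_measurable borel" and B: "\<And>x. cmod (\<rho> x) \<le> B"
    and \<Lambda>: "\<And>f. schwartz f \<Longrightarrow> \<Lambda> f = (LINT x|lborel. f x * \<rho> x)"
  shows "abs_continuous_complex_measure \<Lambda>"
proof -
  define \<mu> where "\<mu> = density lborel (\<lambda>x. ennreal (cmod (\<rho> x)))"
  \<comment> \<open>The value 1 on the zeros of \<open>\<rho>\<close>, a \<open>\<mu>\<close>-null
    set, keeps \<open>h\<close> unimodular.\<close>
  define h where "h x = (if \<rho> x = 0 then 1 else \<rho> x / cmod (\<rho> x))" for x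
  have h[measurable]: "h \<in> borel_measurable borel"
    unfolding h_def by measurable
  have h_\<rho>: "cmod (\<rho> x) *\<^sub>R (f x * h x) = f x * \<rho> x" for f x
    by (simp add: h_def scaleR_conv_of_real)
  show ?thesis
    unfolding abs_continuous_complex_measure_def
  proof (intro exI[of _ \<mu>] exI[of _ h] conjI allI impI)
    show "sets \<mu> = sets borel"
      by (simp add: \<mu>_def)
    show "h \<in> borel_measurable borel"
      by (rule h)
    show "cmod (h x) = 1" for x
      by (simp add: h_def norm_divide)
    show "absolutely_continuous lborel \<mu>"
      unfolding \<mu>_def by (rule absolutely_continuousI_density) simp
  next
    fix K :: "real set" assume K: "compact K"
    then have [measurable]: "K \<in> sets borel"
      by (intro borel_closed compact_imp_closed)
    have "emeasure \<mu> K = (\<integral>\<^sup>+x. ennreal (cmod (\<rho> x)) * indicator K x \<partial>lborel)"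
      unfolding \<mu>_def by (rule emeasure_density) auto
    also have "\<dots> \<le> (\<integral>\<^sup>+x. ennreal B * indicator K x \<partial>lborel)"
      by (intro nn_integral_mono mult_right_mono ennreal_leI B) simp
    also have "\<dots> = ennreal B * emeasure lborel K"
      by (rule nn_integral_cmult_indicator) simp
    also have "\<dots> < \<infinity>"
      using emeasure_compact_finite[OF K] by (simp add: ennreal_mult_less_top)
    finally show "emeasure \<mu> K < \<infinity>" .
  next
    fix f assume f: "schwartz f"
    have [measurable]: "f \<in> borel_measurable borel"
      using schwartz_continuous[OF f] by (rule borel_measurable_continuous_onI)
    have "integrable lborel (\<lambda>x. B * cmod (f x))"
      using schwartz_integrable[OF f] by simp
    then have "integrable lborel (\<lambda>x. cmod (\<rho> x) *\<^sub>R f x)"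
      by (rule Bochner_Integration.integrable_bound)
        (auto intro!: AE_I2 order_trans[OF mult_right_mono[OF B] abs_ge_self])
    then show "integrable \<mu> f"
      unfolding \<mu>_def by (subst integrable_density) auto
    have "(LINT x|\<mu>. f x * h x) = (LINT x|lborel. cmod (\<rho> x) *\<^sub>R (f x * h x))"
      unfolding \<mu>_def by (rule integral_density) auto
    then show "\<Lambda> f = (LINT x|\<mu>. f x * h x)"
      by (simp add: h_\<rho> \<Lambda>[OF f])
  qed
qed

lemma fourier_series_abs_continuous:
  assumes a: "(\<lambda>n. cmod (a n)) summable_on UNIV"
  shows "abs_continuous_complex_measure (\<lambda>f. \<Sum>\<^sub>\<infinity>n::int. fourier f (of_int n * T) * a n)"
proof -
  \<comment> \<open>The terms of the density: modes of frequency \<open>- n * T\<close>, with the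
    \<open>1 / (2 * pi)\<close> of the Fourier convention absorbed.\<close>
  define e where "e j x = a (int_decode j) * exp (- \<i> * (of_int (int_decode j) * T) * of_real x) / (2 * pi)" for j and x :: real
  have norm_e: "cmod (e j x) = cmod (a (int_decode j)) / (2 * pi)" for j x
    by (simp add: e_def norm_mult norm_divide)
  have e_meas[measurable]: "e j \<in> borel_measurable borel" for j
    unfolding e_def by (intro borel_measurable_continuous_onI continuous_intros) auto
  have sum: "summable (\<lambda>j. cmod (a (int_decode j)) / (2 * pi))"
    using summable_on_reindex_bij_betw[OF bij_int_decode, of "\<lambda>n. cmod (a n)"] a
    by (intro summable_divide summable_on_imp_summable) simp
  then have sum_e: "summable (\<lambda>j. cmod (e j x))" for x
    by (simp add: norm_e)
  show ?thesis
  proof (rule abs_continuous_complex_measure_density)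
    show "(\<lambda>x. \<Sum>j. e j x) \<in> borel_measurable borel"
      by measurable
    show "cmod (\<Sum>j. e j x) \<le> (\<Sum>j. cmod (a (int_decode j)) / (2 * pi))" for x
      using summable_norm[OF sum_e[of x]] by (simp add: norm_e)
    fix f assume f: "schwartz f"
    have [measurable]: "f \<in> borel_measurable borel"
      using schwartz_continuous[OF f] by (rule borel_measurable_continuous_onI)
    have int: "integrable lborel (\<lambda>x. f x * e j x)" for j
    proof (rule Bochner_Integration.integrable_bound)
      show "integrable lborel (\<lambda>x. f x * (cmod (a (int_decode j)) / (2 * pi)))"
        using schwartz_integrable[OF f] by simp
    qed (auto simp: norm_mult norm_divide norm_e)
    have term_eq: "fourier f (of_int (int_decode j) * T) * a (int_decode j) = (LINT x|lborel. f x * e j x)" for j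
    proof -
      have "(LINT x|lborel. f x * e j x) = (LINT x|lborel. (a (int_decode j) / (2 * pi)) *
          (f x * exp (- \<i> * (of_int (int_decode j) * T) * x)))"
        by (simp add: e_def mult_ac)
      also have "\<dots> = (a (int_decode j) / (2 * pi)) * (LINT x|lborel. f x * exp (- \<i> * (of_int (int_decode j) * T) * x))"
        by (rule integral_mult_right_zero)
      finally show ?thesis
        by (simp add: fourier_def)
    qed
    have "(\<Sum>\<^sub>\<infinity>n::int. fourier f (of_int n * T) * a n)
        = (\<Sum>j. LINT x|lborel. f x * e j x)"
      by (subst infsum_int_decode[OF fourier_series_summable[OF f a]]) (simp only: term_eq)
    also have "\<dots> = (LINT x|lborel. (\<Sum>j. f x * e j x))"
    \<comment> \<open>The L1 norm of each term is \<open>cmod (a n) / (2 * pi)\<close> times that of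
      \<open>f\<close>, with \<open>n = int_decode j\<close>; these are summable.\<close>
    proof (rule integral_suminf[symmetric])
      show "integrable lborel (\<lambda>x. f x * e j x)" for j
        by (rule int)
      show "AE x in lborel. summable (\<lambda>j. norm (f x * e j x))"
        using sum_e by (simp add: norm_mult summable_mult)
      show "summable (\<lambda>j. LINT x|lborel. norm (f x * e j x))"
        using sum by (simp add: norm_mult norm_e summable_mult)
    qed
    also have "\<dots> = (LINT x|lborel. f x * (\<Sum>j. e j x))"
      using sum_e by (simp add: suminf_mult summable_norm_cancel)
    finally show "(\<Sum>\<^sub>\<infinity>n::int. fourier f (of_int n * T) * a n) = (LINT x|lborel. f x * (\<Sum>j. e j x))" .
  qed
qed

lemma metaplectic_lift_nu_distribution:
  assumes lift: "metaplectic_lift P Q s" and sa: "self_adjoint (real_map (P 1) (Q 1))"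
    and pos: "\<And>x. x \<noteq> 0 \<Longrightarrow> 0 < x \<bullet> real_map (P 1) (Q 1) x"
    and nid: "real_map (P 1) (Q 1) \<noteq> id" and fixed: "real_map (P 1) (Q 1) a = a"
  shows "schwartz f \<Longrightarrow> nu_term T (\<lambda>n. G_number (P n) (s n) a) \<theta> k f summable_on UNIV"
    and "abs_continuous_complex_measure (nu_distribution T (\<lambda>n. G_number (P n) (s n) a) \<theta> k)"
proof -
  \<comment> \<open>The factor of \<open>G_number\<close> shared by all \<open>n\<close>, as
    \<open>matrix_inv (P n)\<close> fixes \<open>a\<close>. The phases in \<open>b\<close> have
    modulus 1, so summability of \<open>s\<close> carries over.\<close>
  define \<kappa> where "\<kappa> = inverse (csqrt (\<Sum>j\<in>UNIV. cnj (a $ j) * a $ j))"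
  define b where "b n = s n * \<kappa> * exp (- \<i> * of_int n * of_nat k * of_real \<theta>)" for n
  have G: "G_number (P n) (s n) a = s n * \<kappa>" for n
    by (simp add: G_number_def \<kappa>_def metaplectic_lift_fixed[OF lift sa fixed])
  have norm_b: "cmod (b n) = cmod (s n) * cmod \<kappa>" for n
    by (simp add: b_def norm_mult)
  have b: "(\<lambda>n. cmod (b n)) summable_on UNIV"
    unfolding norm_b
    by (rule summable_on_cmult_left[OF metaplectic_lift_summable[OF lift sa pos nid]])
  have term_eq: "nu_term T (\<lambda>n. G_number (P n) (s n) a) \<theta> k f
      = (\<lambda>n. fourier f (of_int n * T) * b n)" for f
    by (simp add: nu_term_def b_def G fun_eq_iff mult.assoc)
  show "nu_term T (\<lambda>n. G_number (P n) (s n) a) \<theta> k f summable_on UNIV" if "schwartz f"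
    unfolding term_eq by (rule fourier_series_summable[OF that b])
  show "abs_continuous_complex_measure (nu_distribution T (\<lambda>n. G_number (P n) (s n) a) \<theta> k)"
    unfolding nu_distribution_def term_eq by (rule fourier_series_abs_continuous[OF b])
qed

theorem proposition0p6:
  fixes A :: "('a::{t2_space, second_countable_topology}, 'm::finite) chart set"
    and \<omega> :: "('a, 'm) two_form"
    and p :: "'l \<Rightarrow> 'a" and \<Theta> :: "('a, 'l) triv set" and N :: "'l \<Rightarrow> real"
    and H :: "'a \<Rightarrow> real" and E :: real
    and \<xi> :: "('a, 'm) vfield" and g :: "real \<Rightarrow> 'a \<Rightarrow> 'a"
    and \<xi>h :: "('a, 'm) chart \<Rightarrow> ('a \<Rightarrow> 'l) \<Rightarrow> 'a \<Rightarrow> (complex^'m) \<times> real"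
    and gh :: "real \<Rightarrow> 'a \<times> ('l \<Rightarrow> complex) \<Rightarrow> 'a \<times> ('l \<Rightarrow> complex)"
    and z :: 'a and T \<theta> :: real
    and c :: "('a, 'm) chart" and w :: "complex^'m \<Rightarrow> complex^'m"
    and P Q :: "int \<Rightarrow> 'm cmat" and s :: "int \<Rightarrow> complex"
  assumes "compact_kahler_manifold A \<omega>" and "CARD('m) \<ge> 2"
    and "holomorphic_line_bundle A p \<Theta>" and "hermitian_metric A p \<Theta> N"
    and "curvature_is A p \<Theta> N \<omega>"
    and "smooth_fun A UNIV H" and "hamiltonian_field A \<omega> H \<xi>" and "flow_of A \<xi> g"
    and "horizontal_lift A p \<Theta> N \<xi> \<xi>h" and "circle_flow_of A p \<Theta> N \<xi>h gh"
    and "z \<in> periodic_points g H E" and "minimal_period g z T"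
    and "holonomy_angle (circle_bundle p \<Theta> N) gh z T \<theta>"
    and "c \<in> A" and "z \<in> fst c" and "standard_coords (\<omega> c z) w"
    and "\<forall>n u. w (tangent_map c c (g (of_int n * T)) z u) = P n *v w u + Q n *v cnj_vec (w u)"
    and "metaplectic_lift P Q s"
    and "strongly_hyperbolic (\<omega> c z) (tangent_map c c (g T) z)"
  defines "G \<equiv> \<lambda>n. G_number (P n) (s n) (w (\<xi> c z))"
  shows "\<forall>k. (\<forall>f. schwartz f \<longrightarrow> nu_term T G \<theta> k f summable_on UNIV) \<and>
             abs_continuous_complex_measure (nu_distribution T G \<theta> k)"
proof -
  \<comment> \<open>The case \<open>n = 1\<close> expresses the return map in the coordinates
    \<open>w\<close>, which transfers hyperbolicity and invariance of the generator to
    \<open>real_map (P 1) (Q 1)\<close>.\<close>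
  have D: "w (tangent_map c c (g T) z u) = real_map (P 1) (Q 1) (w u)" for u
    using assms(17)[rule_format, of 1 u] by (simp add: real_map_def)
  have atlas: "complex_atlas A" and period: "g T z = z"
    using assms(1,12) by (simp_all add: compact_kahler_manifold_def minimal_period_def)
  have fixed: "real_map (P 1) (Q 1) (w (\<xi> c z)) = w (\<xi> c z)"
    by (simp add: flow_fixes_generator[OF atlas assms(8,14,15) period] flip: D)
  show ?thesis
    unfolding G_def
    using metaplectic_lift_nu_distribution[OF assms(18)
        strongly_hyperbolic_standard_coords[OF assms(16,19) D linear_real_map assms(2)] fixed]
    by blast
qed

end
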